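(* Let $\sigma<\theta$ be regular cardinals and let $A$ be a progressive set of regular cardinals with $\mathrm{pcf}_{\Gamma^*(\theta,\sigma)}(A)\neq\emptyset$. Then $$\sup\mathrm{pcf}_{\Gamma^*(\theta,\sigma)}(A)=\mathrm{cf}^\sigma_{<\theta}\Bigl(\prod A/ J^{\mathrm{bd}}[A]\Bigr).$$
   Context: A set $A$ of regular cardinals is progressive if $|A|<\min(A)$. $\prod A$ is the set of functions $f$ on $A$ with $f(a)<a$; $\mathrm{tcf}(\prod A/J)=\lambda$ means there is a sequence of length $\lambda$ in $\prod A$, increasing and cofinal modulo the ideal $J$. An ideal is $\sigma$-complete if closed under unions of fewer than $\sigma$ sets. $J^{\mathrm{bd}}[A]$ is the ideal of subsets of $A$ bounded in $\sup(A)$. $\mathrm{pcf}_{\Gamma^*(\theta,\sigma)}(A)$ is the set of cardinals $\lambda$ such that $\lambda=\mathrm{tcf}(\prod A/J)$ for some $\sigma$-complete ideal $J\supseteq J^{\mathrm{bd}}[A]$ on $A$ whose dual filter contains a set of cardinality $<\theta$. A family $F\subseteq\prod A$ is $(\theta,\sigma)$-cofinal in $\prod A/J^{\mathrm{bd}}[A]$ if for every $B\subseteq A$ with $|B|<\theta$ and every $g\in\prod B$ there are $F_0\subseteq F$ with $|F_0|<\sigma$ and $\zeta<\sup(A)$ such that for every $b\in B\setminus\zeta$ some $f\in F_0$ has $g(b)<f(b)$; $\mathrm{cf}^\sigma_{<\theta}(\prod A/J^{\mathrm{bd}}[A])$ is the minimum cardinality of such a family. *)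

theory Defs
  imports "HOL-Library.FuncSet"
begin

unbundle cardinal_syntax

text \<open>
  Ordinals are the elements of an arbitrary type \<open>'a::wellorder\<close>, an element \<open>a\<close> being
  identified with the set \<open>{..<a}\<close> of its predecessors. Cardinals not required to be
  such elements are cardinal orders (\<^const>\<open>card_order_on\<close>), compared by \<open><o\<close>, \<open>\<le>o\<close>, \<open>=o\<close>.
\<close>

definition regular_cardinal :: "'b rel \<Rightarrow> bool" where
  "regular_cardinal r \<longleftrightarrow> Cinfinite r \<and> regularCard r"

definition ord_rel :: "'a::wellorder \<Rightarrow> 'a rel" where
  "ord_rel a = {(x, y). x \<le> y \<and> y < a}"

text \<open>
  \<^const>\<open>card_order_on\<close> asks the well-order of \<open>ord_rel a\<close> itself to be of least possible length
  on its field, so the members of \<open>A\<close> below are initial ordinals.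
\<close>

definition regular_cardinals :: "'a::wellorder set \<Rightarrow> bool" where
  "regular_cardinals A \<longleftrightarrow> (\<forall>a\<in>A. regular_cardinal (ord_rel a))"

definition progressive :: "'a::wellorder set \<Rightarrow> bool" where
  "progressive A \<longleftrightarrow> A \<noteq> {} \<and> |A| <o |{..<(LEAST a. a \<in> A)}|"

definition prod_ord :: "'a::wellorder set \<Rightarrow> ('a \<Rightarrow> 'a) set" where
  "prod_ord A = (\<Pi>\<^sub>E a\<in>A. {..<a})"

text \<open>
  The ordinal \<open>sup A = \<Union>A\<close> is given by its set of predecessors, because it need not be
  an element of \<open>'a\<close>.
\<close>

definition sup_ord :: "'a::wellorder set \<Rightarrow> 'a set" where
  "sup_ord A = (\<Union>a\<in>A. {..<a})"

definition ideal_on :: "'a set \<Rightarrow> 'a set set \<Rightarrow> bool" where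
  "ideal_on A J \<longleftrightarrow> J \<subseteq> Pow A \<and> {} \<in> J \<and> A \<notin> J \<and>
     (\<forall>X\<in>J. \<forall>Y. Y \<subseteq> X \<longrightarrow> Y \<in> J) \<and> (\<forall>X\<in>J. \<forall>Y\<in>J. X \<union> Y \<in> J)"

definition complete_ideal :: "'s rel \<Rightarrow> 'a set set \<Rightarrow> bool" where
  "complete_ideal \<sigma> J \<longleftrightarrow> (\<forall>S. S \<subseteq> J \<and> |S| <o \<sigma> \<longrightarrow> \<Union>S \<in> J)"

definition J_bd :: "'a::wellorder set \<Rightarrow> 'a set set" where
  "J_bd A = {B. B \<subseteq> A \<and> (\<exists>\<zeta>\<in>sup_ord A. B \<subseteq> {..<\<zeta>})}"

definition less_mod :: "'a::wellorder set \<Rightarrow> 'a set set \<Rightarrow> ('a \<Rightarrow> 'a) \<Rightarrow> ('a \<Rightarrow> 'a) \<Rightarrow> bool" where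
  "less_mod A J f g \<longleftrightarrow> {a\<in>A. \<not> f a < g a} \<in> J"

definition le_mod :: "'a::wellorder set \<Rightarrow> 'a set set \<Rightarrow> ('a \<Rightarrow> 'a) \<Rightarrow> ('a \<Rightarrow> 'a) \<Rightarrow> bool" where
  "le_mod A J f g \<longleftrightarrow> {a\<in>A. \<not> f a \<le> g a} \<in> J"

text \<open>
  \<open>has_tcf A J \<kappa>\<close> says that the true cofinality of \<open>\<Prod>A/J\<close> is \<open>\<kappa>\<close>. Regularity of \<open>\<kappa>\<close> is what
  makes the true cofinality unique.
\<close>

definition has_tcf :: "'a::wellorder set \<Rightarrow> 'a set set \<Rightarrow> 'b rel \<Rightarrow> bool" where
  "has_tcf A J \<kappa> \<longleftrightarrow> regular_cardinal \<kappa> \<and>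
     (\<exists>f. (\<forall>i\<in>Field \<kappa>. f i \<in> prod_ord A) \<and>
          (\<forall>i j. (i, j) \<in> \<kappa> \<and> i \<noteq> j \<longrightarrow> less_mod A J (f i) (f j)) \<and>
          (\<forall>g\<in>prod_ord A. \<exists>i\<in>Field \<kappa>. le_mod A J g (f i)))"

text \<open>
  The members of \<open>pcf_Gamma \<theta> \<sigma> A\<close> are all cardinal orders \<open>\<kappa>\<close> of the required kind on the type
  \<open>'a \<Rightarrow> 'a\<close>. No cardinal is lost by fixing this type: see \<open>has_tcf_transfer\<close> below.
\<close>

definition pcf_Gamma :: "'t rel \<Rightarrow> 's rel \<Rightarrow> 'a::wellorder set \<Rightarrow> ('a \<Rightarrow> 'a) rel set" where
  "pcf_Gamma \<theta> \<sigma> A = {\<kappa>. \<exists>J. ideal_on A J \<and> complete_ideal \<sigma> J \<and> J_bd A \<subseteq> J \<and>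
     (\<exists>B. B \<subseteq> A \<and> A - B \<in> J \<and> |B| <o \<theta>) \<and> has_tcf A J \<kappa>}"

definition is_card_Sup :: "'b rel set \<Rightarrow> 'b rel \<Rightarrow> bool" where
  "is_card_Sup R s \<longleftrightarrow> Card_order s \<and> (\<forall>r\<in>R. r \<le>o s) \<and>
     (\<forall>t :: 'b rel. Card_order t \<and> (\<forall>r\<in>R. r \<le>o t) \<longrightarrow> s \<le>o t)"

definition card_Sup :: "'b rel set \<Rightarrow> 'b rel" where
  "card_Sup R = (SOME s. is_card_Sup R s)"

definition theta_sigma_cofinal ::
    "'t rel \<Rightarrow> 's rel \<Rightarrow> 'a::wellorder set \<Rightarrow> ('a \<Rightarrow> 'a) set \<Rightarrow> bool" where
  "theta_sigma_cofinal \<theta> \<sigma> A F \<longleftrightarrow> F \<subseteq> prod_ord A \<and>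
     (\<forall>B g. B \<subseteq> A \<and> |B| <o \<theta> \<and> g \<in> prod_ord B \<longrightarrow>
        (\<exists>F0 \<zeta>. F0 \<subseteq> F \<and> |F0| <o \<sigma> \<and> \<zeta> \<in> sup_ord A \<and>
           (\<forall>b\<in>B - {..<\<zeta>}. \<exists>f\<in>F0. g b < f b)))"

definition is_min_cofinal ::
    "'t rel \<Rightarrow> 's rel \<Rightarrow> 'a::wellorder set \<Rightarrow> ('a \<Rightarrow> 'a) set \<Rightarrow> bool" where
  "is_min_cofinal \<theta> \<sigma> A F \<longleftrightarrow> theta_sigma_cofinal \<theta> \<sigma> A F \<and>
     (\<forall>F'. theta_sigma_cofinal \<theta> \<sigma> A F' \<longrightarrow> |F| \<le>o |F'| )"

definition cf_bd :: "'t rel \<Rightarrow> 's rel \<Rightarrow> 'a::wellorder set \<Rightarrow> ('a \<Rightarrow> 'a) rel" where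
  "cf_bd \<theta> \<sigma> A = |SOME F. is_min_cofinal \<theta> \<sigma> A F|"

text \<open>
  The two choices above are well-defined up to \<open>=o\<close>, and \<open>pcf_Gamma\<close> contains a copy of every
  true cofinality.
\<close>

lemma is_card_Sup_card_Sup: "is_card_Sup R (card_Sup R)" if "\<forall>r\<in>R. Card_order r" for R :: "'b rel set"
proof -
  let ?U = "{s :: 'b rel. Card_order s \<and> (\<forall>r\<in>R. r \<le>o s)}"
  have "r \<le>o |UNIV :: 'b set|" if "r \<in> R" for r
  proof -
    have "r =o |Field r|"
      using \<open>\<forall>r\<in>R. Card_order r\<close> that card_of_Field_ordIso ordIso_symmetric by blast
    then show ?thesis
      using card_of_mono1[of "Field r" UNIV] ordIso_ordLeq_trans by blast
  qed
  then have "|UNIV :: 'b set| \<in> ?U"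
    using card_of_Card_order by blast
  then have "\<exists>s\<in>?U. \<forall>t\<in>?U. s \<le>o t"
    by (intro exists_minim_Card_order) auto
  then have "\<exists>s. is_card_Sup R s"
    unfolding is_card_Sup_def by blast
  then show ?thesis
    unfolding card_Sup_def by (rule someI_ex)
qed

lemma regular_cardinal_ord_rel_limit:
  assumes "regular_cardinal (ord_rel a)" and "x < a"
  shows "\<exists>y<a. x < y"
proof (rule ccontr)
  assume no: "\<not> ?thesis"
  have F: "Field (ord_rel a) = {..<a}"
    by (auto simp: ord_rel_def Field_def)
  have "x \<in> Field (ord_rel a)" using F assms(2) by simp
  moreover have "Card_order (ord_rel a)" "infinite (Field (ord_rel a))"
    using assms(1) unfolding regular_cardinal_def cinfinite_def by auto
  ultimately have "\<exists>y\<in>Field (ord_rel a). x \<noteq> y \<and> (x, y) \<in> ord_rel a"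
    using infinite_Card_order_limit by metis
  then show False using no by (auto simp: ord_rel_def)
qed

lemma is_min_cofinal_exists:
  assumes \<sigma>: "regular_cardinal \<sigma>" and A: "regular_cardinals A" "A \<noteq> {}"
  shows "\<exists>F. is_min_cofinal \<theta> \<sigma> A F"
proof -
  have "theta_sigma_cofinal \<theta> \<sigma> A (prod_ord A)"
    unfolding theta_sigma_cofinal_def
  proof (intro conjI subset_refl allI impI, elim conjE)
    fix B g assume B: "B \<subseteq> A" and g: "g \<in> prod_ord B"
    have lim: "\<exists>y<a. x < y" if "a \<in> A" "x < a" for a x
      using regular_cardinal_ord_rel_limit A(1) that unfolding regular_cardinals_def by blast
    have ne: "\<exists>y. y < a" if "a \<in> A" for a
    proof -
      have "Field (ord_rel a) \<noteq> {}"
        using A(1) that unfolding regular_cardinals_def regular_cardinal_def cinfinite_def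
        by (metis finite.emptyI)
      then show ?thesis by (auto simp: ord_rel_def Field_def)
    qed
    have "\<exists>y<a. a \<in> B \<longrightarrow> g a < y" if "a \<in> A" for a
      using g lim[OF that] ne[OF that] by (cases "a \<in> B") (auto simp: prod_ord_def PiE_iff)
    then obtain h where h: "\<And>a. a \<in> A \<Longrightarrow> h a < a \<and> (a \<in> B \<longrightarrow> g a < h a)"
      by metis
    let ?h = "restrict h A"
    obtain a where a: "a \<in> A" using A(2) by blast
    obtain z where z: "z < a" using ne[OF a] by blast
    have "|{?h}| <o \<sigma>"
      using \<sigma> finite_ordLess_infinite[OF card_of_Well_order, of \<sigma> "{?h}"]
      unfolding regular_cardinal_def cinfinite_def card_order_on_def by (simp add: Field_card_of)
    moreover have "{?h} \<subseteq> prod_ord A" using h by (auto simp: prod_ord_def)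
    moreover have "z \<in> sup_ord A" using a z by (auto simp: sup_ord_def)
    moreover have "\<forall>b\<in>B - {..<z}. \<exists>f\<in>{?h}. g b < f b" using h B by auto
    ultimately show "\<exists>F0 \<zeta>. F0 \<subseteq> prod_ord A \<and> |F0| <o \<sigma> \<and> \<zeta> \<in> sup_ord A \<and>
        (\<forall>b\<in>B - {..<\<zeta>}. \<exists>f\<in>F0. g b < f b)"
      by blast
  qed
  then have "\<exists>r\<in>{ |F| |F. theta_sigma_cofinal \<theta> \<sigma> A F}.
      \<forall>r'\<in>{ |F| |F. theta_sigma_cofinal \<theta> \<sigma> A F}. r \<le>o r'"
    by (intro exists_minim_Card_order) (auto intro: card_of_Card_order)
  then show ?thesis unfolding is_min_cofinal_def by blast
qed

lemma has_tcf_transfer: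
  fixes \<kappa> :: "'b rel" and A :: "'a::wellorder set"
  assumes J: "ideal_on A J" and tcf: "has_tcf A J \<kappa>"
  shows "\<exists>\<mu> :: ('a \<Rightarrow> 'a) rel. \<mu> =o \<kappa> \<and> has_tcf A J \<mu>"
proof -
  obtain f where reg: "regular_cardinal \<kappa>"
    and f: "\<And>i. i \<in> Field \<kappa> \<Longrightarrow> f i \<in> prod_ord A"
    and inc: "\<And>i j. (i, j) \<in> \<kappa> \<Longrightarrow> i \<noteq> j \<Longrightarrow> less_mod A J (f i) (f j)"
    and cof: "\<And>g. g \<in> prod_ord A \<Longrightarrow> \<exists>i\<in>Field \<kappa>. le_mod A J g (f i)"
    using tcf unfolding has_tcf_def by blast
  have wo: "Well_order \<kappa>"
    using reg unfolding regular_cardinal_def card_order_on_def by blast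
  then have tot: "(i, j) \<in> \<kappa> \<or> (j, i) \<in> \<kappa>" if "i \<in> Field \<kappa>" "j \<in> Field \<kappa>" "i \<noteq> j" for i j
    using that unfolding well_order_on_def linear_order_on_def total_on_def by blast
  have irr: "\<not> less_mod A J g g" for g
    using J unfolding less_mod_def ideal_on_def by simp
  have inj: "inj_on f (Field \<kappa>)"
    unfolding inj_on_def using tot inc irr by metis
  define \<mu> where "\<mu> = dir_image \<kappa> f"
  have iso: "\<kappa> =o \<mu>" unfolding \<mu>_def by (rule dir_image_ordIso[OF wo inj])
  have reg\<mu>: "regular_cardinal \<mu>"
    using reg iso regularCard_ordIso[OF iso] Cinfinite_cong[OF iso]
    unfolding regular_cardinal_def by blast
  have Fm: "Field \<mu> = f ` Field \<kappa>" unfolding \<mu>_def by (rule dir_image_Field)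
  have "has_tcf A J \<mu>"
    unfolding has_tcf_def
  proof (intro conjI reg\<mu> exI[of _ "\<lambda>x. x"] ballI allI impI; (elim conjE)?)
    show "x \<in> prod_ord A" if "x \<in> Field \<mu>" for x using that f Fm by auto
    show "less_mod A J x y" if "(x, y) \<in> \<mu>" "x \<noteq> y" for x y
      using that inc unfolding \<mu>_def dir_image_def by auto
    show "\<exists>i\<in>Field \<mu>. le_mod A J g i" if "g \<in> prod_ord A" for g
      using cof[OF that] Fm by auto
  qed
  then show ?thesis using iso ordIso_symmetric by blast
qed

end

theory Submission
  imports Defs
begin

text \<open>
  \<^bold>\<open>Lower bound on the cofinality.\<close> If \<open>tcf(\<Prod>A/J) = \<kappa>\<close> and \<open>|F| < \<kappa>\<close>, then a single \<open>g\<close> bounds \<open>F\<close> modulo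
  \<open>J\<close>. Covering \<open>g\<close> on a small set of the dual filter by fewer than \<open>\<sigma>\<close> members of \<open>F\<close> would put \<open>A\<close>
  into the \<open>\<sigma>\<close>-complete ideal \<open>J\<close>.

  \<^bold>\<open>Upper bound.\<close> A family \<open>F\<close> is cofinal as soon as it is unbounded modulo every proper
  \<open>\<sigma>\<close>-complete ideal that contains \<open>J_bd A\<close> and whose dual filter has a member of size less than
  \<open>\<theta>\<close>. Two facts provide such an \<open>F\<close>. First, for each regular \<open>\<kappa>\<close> one family of size \<open>\<kappa>\<close> is
  unbounded modulo all ideals with true cofinality \<open>\<kappa>\<close> at once: otherwise \<open>\<kappa>\<close>-sequences could be
  improved more than \<open>|A|\<close> times, which produces an injection of a larger cardinal into \<open>A\<close>.
  Second, every \<open>\<sigma>\<close>-complete ideal extends to a \<open>\<sigma>\<close>-complete ideal for which the true cofinality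
  exists. To see this, choose an extension \<open>J\<close> and a family \<open>F\<close> unbounded modulo every further
  extension, with \<open>|F|\<close> least possible. Minimality makes \<open>\<Prod>A/J\<close> \<open>|F|\<close>-directed by the same counting
  argument, so there is an increasing sequence of length \<open>|F|\<close> dominating \<open>F\<close> termwise. A function
  \<open>g\<close> not below any term of it would bound \<open>F\<close> modulo the ideal generated by \<open>J\<close> and the sets
  \<open>{a. g a \<le> f a}\<close>, \<open>f\<close> a term of the sequence. This ideal is \<open>\<sigma>\<close>-complete and proper because the
  complements of these sets decrease modulo \<open>J\<close> along a regular cardinal of size at least \<open>\<sigma>\<close>, so
  the sequence is cofinal.
\<close>

section \<open>Bounded subsets of regular cardinals\<close>

lemma Field_ord_rel: "Field (ord_rel a) = {..<a}"
  by (auto simp: ord_rel_def Field_def)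

lemma regular_cardinal_Well_order: "regular_cardinal r \<Longrightarrow> Well_order r"
  unfolding regular_cardinal_def using card_order_on_well_order_on by blast

text \<open>A set of smaller size is not \<open>cofinal\<close>, so some \<open>i\<close> is not
  strictly below any member of \<open>X\<close>; totality turns this into an upper bound.\<close>

lemma regular_cardinal_bounded:
  assumes r: "regular_cardinal r" and X: "X \<subseteq> Field r" "|X| <o r"
  shows "\<exists>i\<in>Field r. \<forall>x\<in>X. (x, i) \<in> r"
proof -
  have "\<not> cofinal X r"
    using r X not_ordLess_ordIso unfolding regular_cardinal_def regularCard_def by blast
  then obtain i where i: "i \<in> Field r" "\<And>x. x \<in> X \<Longrightarrow> i = x \<or> (i, x) \<notin> r"
    unfolding cofinal_def by blast
  have "Refl r" "Total r"
    using regular_cardinal_Well_order[OF r]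
    unfolding well_order_on_def linear_order_on_def partial_order_on_def preorder_on_def by auto
  then have "(x, i) \<in> r" if "x \<in> X" for x
    using i that X(1) unfolding refl_on_def total_on_def by (metis subsetD)
  then show ?thesis using i(1) by blast
qed

lemma regular_cardinal_Card_order: "regular_cardinal r \<Longrightarrow> Card_order r"
  by (simp add: regular_cardinal_def)

lemma regular_cardinal_infinite: "regular_cardinal r \<Longrightarrow> infinite (Field r)"
  by (simp add: regular_cardinal_def cinfinite_def)

lemma regular_cardinal_card_of: "infinite X \<Longrightarrow> regularCard |X| \<Longrightarrow> regular_cardinal |X|"
  unfolding regular_cardinal_def cinfinite_def using card_of_Card_order[of X] Field_card_of[of X] by simp

lemma regular_cardinal_cong: "regular_cardinal r \<Longrightarrow> r =o s \<Longrightarrow> regular_cardinal s"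
  using regularCard_ordIso[of r s] Cinfinite_cong[of r s] unfolding regular_cardinal_def by blast

lemma ord_rel_card_of:
  assumes "regular_cardinal (ord_rel a)"
  shows "|{..<a}| =o ord_rel a"
  using card_of_Field_ordIso[OF regular_cardinal_Card_order[OF assms]] by (simp add: Field_ord_rel)

lemma regular_ord_strictly_bounded:
  assumes a: "regular_cardinal (ord_rel a)" and X: "X \<subseteq> {..<a}" "|X| <o |{..<a}|"
  shows "\<exists>y<a. \<forall>x\<in>X. x < y"
proof -
  have "|X| <o ord_rel a"
    using X(2) ord_rel_card_of[OF a] ordLess_ordIso_trans by blast
  then have "\<exists>i\<in>{..<a}. \<forall>x\<in>X. (x, i) \<in> ord_rel a"
    using regular_cardinal_bounded[OF a, of X] X(1) by (simp add: Field_ord_rel)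
  then obtain i where "i < a" "\<forall>x\<in>X. x \<le> i"
    by (auto simp: ord_rel_def)
  moreover obtain y where "y < a" "i < y"
    using regular_cardinal_ord_rel_limit[OF a \<open>i < a\<close>] by blast
  ultimately show ?thesis
    by (meson le_less_trans)
qed

lemma card_of_initial_ordLess:
  assumes a: "regular_cardinal (ord_rel a)" and "v < a"
  shows "|{..<v}| <o |{..<a}|"
proof -
  have "underS (ord_rel a) v = {..<v}"
    using \<open>v < a\<close> by (auto simp: underS_def ord_rel_def)
  then have "|{..<v}| <o ord_rel a"
    using card_of_underS[OF regular_cardinal_Card_order[OF a], of v] \<open>v < a\<close>
    by (simp add: Field_ord_rel)
  then show ?thesis
    using ord_rel_card_of[OF a] ordIso_symmetric ordLess_ordIso_trans by blast
qed

lemma finite_ordLess_regular: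
  assumes "finite X" "regular_cardinal r"
  shows "|X| <o r"
  using regular_cardinal_infinite[OF assms(2)] regular_cardinal_Well_order[OF assms(2)]
    finite_ordLess_infinite[OF card_of_Well_order, of r X] assms(1)
  by (simp add: Field_card_of)

section \<open>Comparison of functions modulo an ideal\<close>

lemma ideal_onD:
  assumes "ideal_on A J"
  shows "A \<notin> J" "X \<in> J \<Longrightarrow> X \<subseteq> A" "X \<in> J \<Longrightarrow> Y \<subseteq> X \<Longrightarrow> Y \<in> J"
    "X \<in> J \<Longrightarrow> Y \<in> J \<Longrightarrow> X \<union> Y \<in> J"
  using assms unfolding ideal_on_def by blast+

lemma ideal_on_subset_Un:
  "ideal_on A J \<Longrightarrow> X \<in> J \<Longrightarrow> Y \<in> J \<Longrightarrow> Z \<subseteq> X \<union> Y \<Longrightarrow> Z \<in> J"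
  using ideal_onD by metis

text \<open>A proper ideal cannot cover \<open>A\<close>. The counting arguments use this to find
  one point outside several exceptional sets.\<close>

lemma ideal_on_ex_notin:
  assumes J: "ideal_on A J" and "X \<in> J" "Y \<in> J" "Z \<in> J"
  shows "\<exists>a\<in>A. a \<notin> X \<and> a \<notin> Y \<and> a \<notin> Z"
proof (rule ccontr)
  assume "\<not> ?thesis"
  then have "A \<subseteq> X \<union> (Y \<union> Z)" by blast
  then have "A \<in> J" using ideal_onD(3,4)[OF J] assms(2-4) by metis
  then show False using ideal_onD(1)[OF J] by blast
qed

lemma less_mod_mono: "less_mod A J f g \<Longrightarrow> J \<subseteq> J' \<Longrightarrow> less_mod A J' f g"
  unfolding less_mod_def by blast

lemma less_mod_trans:
  assumes "ideal_on A J" "less_mod A J f g" "less_mod A J g h"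
  shows "less_mod A J f h"
  using assms(2,3) unfolding less_mod_def
  by (rule ideal_on_subset_Un[OF assms(1)]) auto

lemma le_less_mod_trans:
  assumes "ideal_on A J" "le_mod A J f g" "less_mod A J g h"
  shows "less_mod A J f h"
  using assms(2,3) unfolding less_mod_def le_mod_def
  by (rule ideal_on_subset_Un[OF assms(1)]) auto

lemma less_le_mod_trans:
  assumes "ideal_on A J" "less_mod A J f g" "le_mod A J g h"
  shows "less_mod A J f h"
  using assms(2,3) unfolding less_mod_def le_mod_def
  by (rule ideal_on_subset_Un[OF assms(1)]) auto

lemma less_mod_irrefl: "ideal_on A J \<Longrightarrow> \<not> less_mod A J f f"
  unfolding less_mod_def ideal_on_def by simp

lemma less_imp_le_mod: "ideal_on A J \<Longrightarrow> less_mod A J f g \<Longrightarrow> le_mod A J f g"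
  unfolding less_mod_def le_mod_def
  by (erule ideal_onD(3)[of A J]) auto

section \<open>Bounded families and tails of a progressive set\<close>

text \<open>Strictness is harmless: members of \<open>A\<close> are limit ordinals, so a weak bound
  can be raised pointwise (\<open>bounded_modI_le\<close>).\<close>

definition bounded_mod :: "'a::wellorder set \<Rightarrow> 'a set set \<Rightarrow> ('a \<Rightarrow> 'a) set \<Rightarrow> bool" where
  "bounded_mod A J F \<longleftrightarrow> (\<exists>g\<in>prod_ord A. \<forall>f\<in>F. less_mod A J f g)"

text \<open>
  \<open>T\<close> is a set that is large modulo every ideal under consideration. Since \<open>v\<close> lies below
  every member of \<open>T\<close>, families indexed by \<open>{..<v}\<close> have pointwise upper bounds on \<open>T\<close>, while a
  strictly monotone chain of subsets of \<open>T\<close> cannot have length \<open>v\<close>.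
\<close>

locale progressive_tail =
  fixes A T :: "'a::wellorder set" and v :: 'a
  assumes regular: "regular_cardinals A" and T_subset: "T \<subseteq> A"
    and v_less: "a \<in> T \<Longrightarrow> v < a" and T_less: "|T| <o |{..<v}|"
begin

lemma regular_ord: "a \<in> A \<Longrightarrow> regular_cardinal (ord_rel a)"
  using regular unfolding regular_cardinals_def by blast

lemma finite_bounded:
  assumes "finite X" "X \<subseteq> {..<a}" "a \<in> A"
  shows "\<exists>y<a. \<forall>x\<in>X. x < y"
proof -
  have "|X| <o |{..<a}|"
    using finite_ordLess_regular[OF assms(1) regular_ord[OF assms(3)]]
      ord_rel_card_of[OF regular_ord[OF assms(3)]] ordIso_symmetric ordLess_ordIso_trans by blast
  then show ?thesis
    using regular_ord_strictly_bounded regular_ord assms(2,3) by blast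
qed

lemma prod_ord_pointwise_bound:
  assumes "\<And>a. a \<in> A \<Longrightarrow> \<exists>y<a. P a y"
  shows "\<exists>g\<in>prod_ord A. \<forall>a\<in>A. P a (g a)"
proof -
  obtain h where h: "\<And>a. a \<in> A \<Longrightarrow> h a < a \<and> P a (h a)"
    using assms by metis
  then have "restrict h A \<in> prod_ord A" "\<forall>a\<in>A. P a (restrict h A a)"
    by (auto simp: prod_ord_def)
  then show ?thesis by blast
qed

lemma prod_ord_less: "f \<in> prod_ord A \<Longrightarrow> a \<in> A \<Longrightarrow> f a < a"
  by (auto simp: prod_ord_def PiE_iff)

lemma small_pointwise_bound:
  assumes "G \<subseteq> prod_ord A" "|G| \<le>o |{..<v}|"
  shows "\<exists>g\<in>prod_ord A. \<forall>f\<in>G. \<forall>a\<in>T. f a < g a"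
proof -
  have "\<exists>y<a. a \<in> T \<longrightarrow> (\<forall>f\<in>G. f a < y)" if a: "a \<in> A" for a
  proof (cases "a \<in> T")
    case True
    have "|(\<lambda>f. f a) ` G| \<le>o |{..<v}|"
      using card_of_image assms(2) ordLeq_transitive by blast
    then have "|(\<lambda>f. f a) ` G| <o |{..<a}|"
      using card_of_initial_ordLess[OF regular_ord[OF a] v_less[OF True]] ordLeq_ordLess_trans
      by blast
    then have "\<exists>y<a. \<forall>x\<in>(\<lambda>f. f a) ` G. x < y"
      using assms(1) a prod_ord_less
      by (intro regular_ord_strictly_bounded regular_ord) auto
    then show ?thesis by blast
  next
    case False
    then show ?thesis using finite_bounded[of "{}" a] a by auto
  qed
  from prod_ord_pointwise_bound[of "\<lambda>a y. a \<in> T \<longrightarrow> (\<forall>f\<in>G. f a < y)", OF this]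
  show ?thesis using T_subset by blast
qed

text \<open>Regular cardinals are infinite, so this bound works on all of \<open>A\<close>. It is
  not a case of \<open>small_pointwise_bound\<close>, which only reaches \<open>T\<close>; moreover
  \<open>{..<v}\<close> may be finite.\<close>

lemma finite_pointwise_bound:
  assumes "G \<subseteq> prod_ord A" "finite G"
  shows "\<exists>g\<in>prod_ord A. \<forall>f\<in>G. \<forall>a\<in>A. f a < g a"
proof -
  have "\<exists>y<a. \<forall>f\<in>G. f a < y" if a: "a \<in> A" for a
    using finite_bounded[of "(\<lambda>f. f a) ` G" a] assms a prod_ord_less by auto
  from prod_ord_pointwise_bound[of "\<lambda>a y. \<forall>f\<in>G. f a < y", OF this]
  show ?thesis by blast
qed

definition admissible :: "'a set set \<Rightarrow> bool" where
  "admissible J \<longleftrightarrow> ideal_on A J \<and> A - T \<in> J"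

lemma admissible_ideal: "admissible J \<Longrightarrow> ideal_on A J"
  by (simp add: admissible_def)

lemma admissible_less_modI:
  assumes "admissible J" "\<And>a. a \<in> T \<Longrightarrow> f a < g a"
  shows "less_mod A J f g"
  unfolding less_mod_def
  by (rule ideal_onD(3)[of A J "A - T"]) (use assms in \<open>auto simp: admissible_def\<close>)

lemma bounded_modI_le:
  assumes J: "admissible J" and g: "g \<in> prod_ord A" and le: "\<And>f. f \<in> F \<Longrightarrow> le_mod A J f g"
  shows "bounded_mod A J F"
proof -
  obtain g' where g': "g' \<in> prod_ord A" "\<forall>a\<in>A. g a < g' a"
    using finite_pointwise_bound[of "{g}"] g by auto
  then have "less_mod A J g g'"
    using admissible_less_modI[OF J] T_subset by blast
  then show ?thesis
    using le_less_mod_trans[OF admissible_ideal[OF J] le] g'(1) unfolding bounded_mod_def by blast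
qed

lemma small_bounded_mod:
  assumes "admissible J" "G \<subseteq> prod_ord A" "|G| \<le>o |{..<v}|"
  shows "bounded_mod A J G"
  using small_pointwise_bound[OF assms(2,3)] admissible_less_modI[OF assms(1)]
  unfolding bounded_mod_def by metis

lemma finite_bounded_mod:
  assumes "admissible J" "G \<subseteq> prod_ord A" "finite G"
  shows "bounded_mod A J G"
  using finite_pointwise_bound[OF assms(2,3)] admissible_less_modI[OF assms(1)] T_subset
  unfolding bounded_mod_def by (metis subsetD)

text \<open>A cofinal sequence of length at most \<open>|{..<v}|\<close> would have a strict upper
  bound, hence a function strictly below itself.\<close>

lemma has_tcf_ordLess:
  assumes J: "admissible J" and "has_tcf A J \<kappa>"
  shows "|{..<v}| <o \<kappa>"
proof (rule ccontr)
  assume "\<not> ?thesis"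
  obtain f where reg: "regular_cardinal \<kappa>"
    and f: "\<And>i. i \<in> Field \<kappa> \<Longrightarrow> f i \<in> prod_ord A"
    and cof: "\<And>g. g \<in> prod_ord A \<Longrightarrow> \<exists>i\<in>Field \<kappa>. le_mod A J g (f i)"
    using assms(2) unfolding has_tcf_def by blast
  from \<open>\<not> |{..<v}| <o \<kappa>\<close> have "\<kappa> \<le>o |{..<v}|"
    using ordLess_or_ordLeq card_of_Well_order regular_cardinal_Well_order[OF reg] by blast
  then have "|Field \<kappa>| \<le>o |{..<v}|"
    using card_of_Field_ordIso[OF regular_cardinal_Card_order[OF reg]] ordIso_ordLeq_trans by blast
  then have "|f ` Field \<kappa>| \<le>o |{..<v}|"
    using card_of_image ordLeq_transitive by blast
  then have "bounded_mod A J (f ` Field \<kappa>)"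
    using small_bounded_mod[OF J] f by blast
  then obtain g where "g \<in> prod_ord A" "\<And>i. i \<in> Field \<kappa> \<Longrightarrow> less_mod A J (f i) g"
    unfolding bounded_mod_def by auto
  then show False
    using cof less_le_mod_trans[OF admissible_ideal[OF J]] less_mod_irrefl[OF admissible_ideal[OF J]] by metis
qed

section \<open>Iterated improvement and families unbounded for one given cofinality\<close>

text \<open>At a stage below \<open>v\<close> the improvements of the earlier stages are at most
  \<open>|{..<v}|\<close> many functions for each index, so they have a common bound on
  \<open>T\<close>. \<open>step\<close> takes a whole family because in
  \<open>universal_family\<close> the improvement depends on the entire sequence.\<close>

lemma iterate_steps:
  fixes step :: "('i \<Rightarrow> 'a \<Rightarrow> 'a) \<Rightarrow> ('i \<Rightarrow> 'a \<Rightarrow> 'a)"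
  assumes step: "\<And>f. (\<forall>i\<in>I. f i \<in> prod_ord A) \<Longrightarrow> (\<forall>i\<in>I. step f i \<in> prod_ord A)"
  shows "\<exists>s. \<forall>\<alpha><v. \<forall>i\<in>I. s \<alpha> i \<in> prod_ord A \<and>
    (\<forall>\<beta><\<alpha>. \<forall>a\<in>T. step (s \<beta>) i a < s \<alpha> i a)"
proof -
  \<comment> \<open>The recursion runs over the whole type; the guard makes the requirement vacuous
    from \<open>v\<close> on.\<close>
  let ?P = "\<lambda>s \<alpha> r. \<alpha> < v \<longrightarrow> (\<forall>i\<in>I. r i \<in> prod_ord A \<and>
    (\<forall>\<beta><\<alpha>. \<forall>a\<in>T. step (s \<beta>) i a < r i a))"
  have "\<exists>s. \<forall>\<alpha>. ?P s \<alpha> (s \<alpha>)"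
  proof (rule dependent_wf_choice)
    show "wf {(x, y). x < (y::'a)}" by (rule wf)
    show "?P f x r = ?P g x r" if "\<And>z. (z, x) \<in> {(x, y). x < y} \<Longrightarrow> f z = g z" for f g x r
      using that by simp
    fix \<alpha> :: 'a and s :: "'a \<Rightarrow> 'i \<Rightarrow> 'a \<Rightarrow> 'a"
    assume IH: "\<And>y. (y, \<alpha>) \<in> {(x, y). x < y} \<Longrightarrow> ?P s y (s y)"
    have "\<exists>g\<in>prod_ord A. \<forall>f\<in>(\<lambda>\<beta>. step (s \<beta>) i) ` {..<\<alpha>}. \<forall>a\<in>T. f a < g a"
      if "\<alpha> < v" "i \<in> I" for i
    proof (rule small_pointwise_bound)
      have "\<forall>j\<in>I. s \<beta> j \<in> prod_ord A" if "\<beta> < \<alpha>" for \<beta>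
        using IH[of \<beta>] that less_trans[OF that \<open>\<alpha> < v\<close>] by simp
      then show "(\<lambda>\<beta>. step (s \<beta>) i) ` {..<\<alpha>} \<subseteq> prod_ord A"
        using step \<open>i \<in> I\<close> by auto
      have "{..<\<alpha>} \<subseteq> {..<v}" using \<open>\<alpha> < v\<close> by auto
      then show "|(\<lambda>\<beta>. step (s \<beta>) i) ` {..<\<alpha>}| \<le>o |{..<v}|"
        using card_of_image card_of_mono1 ordLeq_transitive by blast
    qed
    then have "\<exists>r. \<forall>i. \<alpha> < v \<and> i \<in> I \<longrightarrow> r i \<in> prod_ord A \<and>
        (\<forall>\<beta><\<alpha>. \<forall>a\<in>T. step (s \<beta>) i a < r i a)"
      by (intro choice) fastforce
    then show "\<exists>r. ?P s \<alpha> r" by blast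
  qed
  then show ?thesis by blast
qed

text \<open>This ends both counting arguments: each of the \<open>v\<close> stages produces a point
  of \<open>T\<close>, and different stages produce different points.\<close>

lemma no_injection:
  assumes "\<And>\<alpha>. \<alpha> < v \<Longrightarrow> x \<alpha> \<in> T" "\<And>\<alpha> \<beta>. \<alpha> < \<beta> \<Longrightarrow> \<beta> < v \<Longrightarrow> x \<alpha> \<noteq> x \<beta>"
  shows False
proof -
  have "inj_on x {..<v}"
    unfolding inj_on_def by (metis assms(2) lessThan_iff linorder_neqE)
  moreover have "x ` {..<v} \<subseteq> T" using assms(1) by blast
  ultimately have "|{..<v}| \<le>o |T|" using card_of_ordLeq by blast
  then show False using T_less not_ordLess_ordLeq by blast
qed

lemma index_bound:
  assumes r: "regular_cardinal r" "|{..<v}| <o r" and i: "\<And>\<alpha>. \<alpha> < v \<Longrightarrow> i \<alpha> \<in> Field r"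
  shows "\<exists>k\<in>Field r. \<forall>\<alpha><v. (i \<alpha>, k) \<in> r"
proof -
  have "|i ` {..<v}| <o r"
    using card_of_image r(2) ordLeq_ordLess_trans by blast
  then show ?thesis
    using regular_cardinal_bounded[OF r(1), of "i ` {..<v}"] i by auto
qed

lemma prod_ord_nonempty: "\<exists>g. g \<in> prod_ord A"
  using finite_pointwise_bound[of "{}"] by auto

lemma max_prod_ord:
  "f \<in> prod_ord A \<Longrightarrow> g \<in> prod_ord A \<Longrightarrow> (\<lambda>a\<in>A. max (f a) (g a)) \<in> prod_ord A"
  using prod_ord_less by (auto simp: prod_ord_def)

text \<open>Otherwise every \<kappa>-sequence is bounded modulo some ideal with true cofinality
  \<kappa>, and can be replaced by one above a sequence cofinal for that ideal. Doing so
  \<open>v\<close> times gives too many points of \<open>T\<close>.\<close>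

lemma universal_family:
  fixes \<kappa> :: "'b rel"
  assumes \<kappa>: "regular_cardinal \<kappa>"
  shows "\<exists>F\<subseteq>prod_ord A. |F| \<le>o \<kappa> \<and>
    (\<forall>J. admissible J \<and> has_tcf A J \<kappa> \<longrightarrow> \<not> bounded_mod A J F)"
proof (rule ccontr)
  assume no: "\<not> ?thesis"
  define dom where "dom f \<longleftrightarrow> (\<forall>i\<in>Field \<kappa>. f i \<in> prod_ord A)" for f :: "'b \<Rightarrow> 'a \<Rightarrow> 'a"
  \<comment> \<open>For a sequence \<open>f\<close>: an ideal \<open>J\<close> that refutes it, a
    bound \<open>g\<close> modulo \<open>J\<close>, and a sequence \<open>e\<close> witnessing the
    true cofinality.\<close>
  define Q where "Q f J g e \<longleftrightarrow> admissible J \<and> has_tcf A J \<kappa> \<and> g \<in> prod_ord A \<and>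
      (\<forall>i\<in>Field \<kappa>. less_mod A J (f i) g) \<and> dom e \<and>
      (\<forall>i j. (i, j) \<in> \<kappa> \<and> i \<noteq> j \<longrightarrow> less_mod A J (e i) (e j)) \<and>
      (\<forall>h\<in>prod_ord A. \<exists>i\<in>Field \<kappa>. le_mod A J h (e i))"
    for f J g e
  have "\<exists>J g e. Q f J g e" if "dom f" for f
  proof -
    have "|f ` Field \<kappa>| \<le>o \<kappa>"
      using card_of_image card_of_Field_ordIso[OF regular_cardinal_Card_order[OF \<kappa>]]
        ordLeq_ordIso_trans by blast
    moreover have "f ` Field \<kappa> \<subseteq> prod_ord A" using that unfolding dom_def by blast
    ultimately obtain J where J: "admissible J" "has_tcf A J \<kappa>" "bounded_mod A J (f ` Field \<kappa>)"
      using no by blast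
    from J(3) obtain g where "g \<in> prod_ord A" "\<forall>i\<in>Field \<kappa>. less_mod A J (f i) g"
      unfolding bounded_mod_def by auto
    moreover from J(2) obtain e where "dom e"
      "\<forall>i j. (i, j) \<in> \<kappa> \<and> i \<noteq> j \<longrightarrow> less_mod A J (e i) (e j)"
      "\<forall>h\<in>prod_ord A. \<exists>i\<in>Field \<kappa>. le_mod A J h (e i)"
      unfolding has_tcf_def dom_def by auto
    ultimately show ?thesis using J(1,2) unfolding Q_def by blast
  qed
  then obtain J g e where Q: "\<And>f. dom f \<Longrightarrow> Q f (J f) (g f) (e f)"
    by metis
  then have J: "\<And>f. dom f \<Longrightarrow> admissible (J f)"
    and tcf: "\<And>f. dom f \<Longrightarrow> has_tcf A (J f) \<kappa>"
    and g: "\<And>f. dom f \<Longrightarrow> g f \<in> prod_ord A"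
    and fg: "\<And>f i. dom f \<Longrightarrow> i \<in> Field \<kappa> \<Longrightarrow> less_mod A (J f) (f i) (g f)"
    and e: "\<And>f. dom f \<Longrightarrow> dom (e f)"
    and inc: "\<And>f i j. dom f \<Longrightarrow> (i, j) \<in> \<kappa> \<Longrightarrow> i \<noteq> j \<Longrightarrow> less_mod A (J f) (e f i) (e f j)"
    and cof: "\<And>f h. dom f \<Longrightarrow> h \<in> prod_ord A \<Longrightarrow> \<exists>i\<in>Field \<kappa>. le_mod A (J f) h (e f i)"
    unfolding Q_def by blast+
  \<comment> \<open>Any sequence at all yields an ideal with true cofinality \<kappa>; a constant
    one is enough to compare \<kappa> with \<open>v\<close>.\<close>
  obtain g0 where "g0 \<in> prod_ord A" using prod_ord_nonempty by blast
  then have "dom (\<lambda>_. g0)" by (simp add: dom_def)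
  then have v\<kappa>: "|{..<v}| <o \<kappa>" using has_tcf_ordLess J tcf by blast
  define step where "step f i = (\<lambda>a\<in>A. max (e f i a) (g f a))" for f i
  have "\<exists>s. \<forall>\<alpha><v. \<forall>i\<in>Field \<kappa>. s \<alpha> i \<in> prod_ord A \<and>
    (\<forall>\<beta><\<alpha>. \<forall>a\<in>T. step (s \<beta>) i a < s \<alpha> i a)"
  proof (rule iterate_steps[where step = step])
    fix f assume "\<forall>i\<in>Field \<kappa>. f i \<in> prod_ord A"
    then have "dom f" by (simp add: dom_def)
    then show "\<forall>i\<in>Field \<kappa>. step f i \<in> prod_ord A"
      using e g max_prod_ord unfolding step_def dom_def by blast
  qed
  then obtain s where s: "\<And>\<alpha>. \<alpha> < v \<Longrightarrow> dom (s \<alpha>)"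
    and lt: "\<And>\<alpha> \<beta> i a. \<alpha> < v \<Longrightarrow> \<beta> < \<alpha> \<Longrightarrow> i \<in> Field \<kappa> \<Longrightarrow> a \<in> T \<Longrightarrow>
      step (s \<beta>) i a < s \<alpha> i a"
    unfolding dom_def by blast
  have "\<exists>h\<in>prod_ord A. \<forall>f\<in>(\<lambda>\<alpha>. g (s \<alpha>)) ` {..<v}. \<forall>a\<in>T. f a < h a"
    using g s by (intro small_pointwise_bound card_of_image) auto
  then obtain h where h: "h \<in> prod_ord A" "\<And>\<alpha> a. \<alpha> < v \<Longrightarrow> a \<in> T \<Longrightarrow> g (s \<alpha>) a < h a"
    by auto
  have "\<exists>i\<in>Field \<kappa>. le_mod A (J (s \<alpha>)) h (e (s \<alpha>) i)" if "\<alpha> < v" for \<alpha>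
    using cof s h(1) that by blast
  then obtain i where i: "\<And>\<alpha>. \<alpha> < v \<Longrightarrow> i \<alpha> \<in> Field \<kappa>"
    "\<And>\<alpha>. \<alpha> < v \<Longrightarrow> le_mod A (J (s \<alpha>)) h (e (s \<alpha>) (i \<alpha>))"
    by metis
  \<comment> \<open>The ideals differ from stage to stage, but \<kappa> is regular and exceeds
    \<open>|{..<v}|\<close>, so one index serves all stages.\<close>
  obtain k where k: "k \<in> Field \<kappa>" "\<And>\<alpha>. \<alpha> < v \<Longrightarrow> (i \<alpha>, k) \<in> \<kappa>"
    using index_bound[OF \<kappa> v\<kappa>, of i] i(1) by blast
  \<comment> \<open>At this point the \<open>k\<close>-th function crosses \<open>h\<close>: it is
    below \<open>h\<close> at stage \<alpha> and above \<open>h\<close> at all later stages. Hence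
    each point is used only once.\<close>
  have "\<exists>a\<in>T. s \<alpha> k a < h a \<and> h a \<le> e (s \<alpha>) k a" if \<alpha>: "\<alpha> < v" for \<alpha>
  proof -
    have ad: "admissible (J (s \<alpha>))" and id: "ideal_on A (J (s \<alpha>))"
      using J s \<alpha> admissible_ideal by blast+
    have "le_mod A (J (s \<alpha>)) h (e (s \<alpha>) k)"
    proof (cases "i \<alpha> = k")
      case False
      then have "less_mod A (J (s \<alpha>)) (e (s \<alpha>) (i \<alpha>)) (e (s \<alpha>) k)"
        using inc s k(2) \<alpha> by blast
      then show ?thesis
        using le_less_mod_trans[OF id i(2)[OF \<alpha>]] less_imp_le_mod[OF id] by blast
    qed (use i(2) \<alpha> in auto)
    then obtain a where "a \<in> A" "a \<notin> A - T" "a \<notin> {a \<in> A. \<not> h a \<le> e (s \<alpha>) k a}"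
        "a \<notin> {a \<in> A. \<not> s \<alpha> k a < g (s \<alpha>) a}"
      using ideal_on_ex_notin[OF id, of "A - T"] ad fg[OF s[OF \<alpha>] k(1)]
      unfolding le_mod_def less_mod_def admissible_def by meson
    then show ?thesis using h(2)[OF \<alpha>] by (auto intro: less_trans)
  qed
  then obtain x where x: "\<And>\<alpha>. \<alpha> < v \<Longrightarrow> x \<alpha> \<in> T" "\<And>\<alpha>. \<alpha> < v \<Longrightarrow> s \<alpha> k (x \<alpha>) < h (x \<alpha>)"
    "\<And>\<alpha>. \<alpha> < v \<Longrightarrow> h (x \<alpha>) \<le> e (s \<alpha>) k (x \<alpha>)"
    by metis
  have "x \<alpha> \<noteq> x \<beta>" if "\<alpha> < \<beta>" "\<beta> < v" for \<alpha> \<beta>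
  proof
    assume eq: "x \<alpha> = x \<beta>"
    have \<alpha>: "\<alpha> < v" using that by (rule less_trans)
    have "h (x \<alpha>) \<le> step (s \<alpha>) k (x \<alpha>)"
      using x(1,3)[OF \<alpha>] T_subset by (auto simp: step_def le_max_iff_disj)
    also have "\<dots> < s \<beta> k (x \<alpha>)" using lt that k(1) x(1)[OF \<alpha>] by blast
    finally show False using x(2)[OF that(2)] eq by simp
  qed
  then show False using no_injection[of x] x(1) by blast
qed

section \<open>Directedness of the product modulo an ideal\<close>

text \<open>Recursion along the well-order \<open>|G|\<close>: the values at the predecessors of
  \<open>x\<close>, together with \<open>x\<close> itself, are fewer than \<open>|G|\<close>
  functions and hence bounded.\<close>

lemma increasing_sequence:
  assumes J: "admissible J" and G: "G \<subseteq> prod_ord A" "infinite G"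
    and small: "\<forall>H\<subseteq>prod_ord A. |H| <o |G| \<longrightarrow> bounded_mod A J H"
  shows "\<exists>f. \<forall>x\<in>G. f x \<in> prod_ord A \<and> less_mod A J x (f x) \<and>
    (\<forall>y. (y, x) \<in> |G| \<and> y \<noteq> x \<longrightarrow> less_mod A J (f y) (f x))"
proof -
  let ?P = "\<lambda>f x r. x \<in> G \<longrightarrow> r \<in> prod_ord A \<and> less_mod A J x r \<and>
    (\<forall>y. (y, x) \<in> |G| \<and> y \<noteq> x \<longrightarrow> less_mod A J (f y) r)"
  have "\<exists>f. \<forall>x. ?P f x (f x)"
  proof (rule dependent_wf_choice)
    show "wf ( |G| - Id)"
      using card_of_Well_order unfolding well_order_on_def by blast
    show "?P f x r = ?P g x r" if "\<And>z. (z, x) \<in> |G| - Id \<Longrightarrow> f z = g z" for f g x r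
      using that by auto
    fix x and f :: "('a \<Rightarrow> 'a) \<Rightarrow> 'a \<Rightarrow> 'a"
    assume IH: "\<And>y. (y, x) \<in> |G| - Id \<Longrightarrow> ?P f y (f y)"
    show "\<exists>r. ?P f x r"
    proof (cases "x \<in> G")
      case True
      have "|underS |G| x| <o |G|"
        using card_of_underS[OF card_of_Card_order] True by (simp add: Field_card_of)
      then have "|f ` underS |G| x| <o |G|"
        using card_of_image ordLeq_ordLess_trans by blast
      moreover have "|{x}| <o |G|"
        using G(2) finite_ordLess_infinite[OF card_of_Well_order card_of_Well_order]
        by (metis Field_card_of finite.emptyI finite.insertI)
      ultimately have "|{x} \<union> f ` underS |G| x| <o |G|"
        using card_of_Un_ordLess_infinite[OF G(2)] by blast
      moreover have "{x} \<union> f ` underS |G| x \<subseteq> prod_ord A"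
        using IH True G(1) FieldI1[of _ x "|G|"] by (auto simp: underS_def Field_card_of)
      ultimately obtain r where "r \<in> prod_ord A" "\<forall>f\<in>{x} \<union> f ` underS |G| x. less_mod A J f r"
        using small unfolding bounded_mod_def by blast
      then show ?thesis by (auto simp: underS_def)
    qed simp
  qed
  then show ?thesis by blast
qed

text \<open>A cofinal \<open>K\<close> of smaller size indexes a bounded part of the increasing
  sequence, and that part already dominates every member of \<open>G\<close>.\<close>

lemma singular_bounded_mod:
  assumes J: "admissible J" and G: "G \<subseteq> prod_ord A" "infinite G"
    and small: "\<forall>H\<subseteq>prod_ord A. |H| <o |G| \<longrightarrow> bounded_mod A J H"
    and sing: "\<not> regularCard |G|"
  shows "bounded_mod A J G"
proof -
  obtain f where f: "\<And>x. x \<in> G \<Longrightarrow> f x \<in> prod_ord A" "\<And>x. x \<in> G \<Longrightarrow> less_mod A J x (f x)"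
    "\<And>x y. x \<in> G \<Longrightarrow> (y, x) \<in> |G| \<Longrightarrow> y \<noteq> x \<Longrightarrow> less_mod A J (f y) (f x)"
    using increasing_sequence[OF J G small] by blast
  obtain K where K: "K \<subseteq> G" "cofinal K |G|" "\<not> |K| =o |G|"
    using sing unfolding regularCard_def by (auto simp: Field_card_of)
  have "|K| <o |G|"
    using K(1,3) card_of_mono1 ordLeq_iff_ordLess_or_ordIso by blast
  then have "|f ` K| <o |G|"
    using card_of_image ordLeq_ordLess_trans by blast
  moreover have "f ` K \<subseteq> prod_ord A" using f(1) K(1) by blast
  ultimately have "bounded_mod A J (f ` K)" using small by simp
  then obtain g where g: "g \<in> prod_ord A" "\<And>x. x \<in> K \<Longrightarrow> less_mod A J (f x) g"
    unfolding bounded_mod_def by auto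
  have "less_mod A J y g" if "y \<in> G" for y
  proof -
    have "\<exists>x\<in>K. y \<noteq> x \<and> (y, x) \<in> |G|"
      using K(2) that by (simp add: cofinal_def Field_card_of)
    then obtain x where x: "x \<in> K" "y \<noteq> x" "(y, x) \<in> |G|"
      by (elim bexE conjE)
    have "less_mod A J (f y) (f x)" using f(3)[of x y] x K(1) by auto
    then show ?thesis
      using less_mod_trans[OF admissible_ideal[OF J]] f(2)[OF that] g(2)[OF x(1)] by metis
  qed
  then show ?thesis using g(1) unfolding bounded_mod_def by blast
qed

text \<open>The hypothesis \<open>loc\<close> bounds small families only after passing to an ideal
  that concentrates on a given positive set. If no single bound worked modulo \<open>J\<close>,
  these partial bounds could be iterated \<open>v\<close> times, again giving too many points of
  \<open>T\<close>.\<close>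

lemma regular_bounded_mod:
  fixes \<mu> :: "('a \<Rightarrow> 'a) rel"
  assumes J: "admissible J"
    and loc: "\<forall>X\<subseteq>A. X \<notin> J \<longrightarrow> (\<forall>H\<subseteq>prod_ord A. |H| <o \<mu> \<longrightarrow>
      (\<exists>J'. admissible J' \<and> J \<subseteq> J' \<and> A - X \<in> J' \<and> bounded_mod A J' H))"
    and G: "G \<subseteq> prod_ord A" and lam: "|G| <o \<mu>"
    and small: "\<forall>H\<subseteq>prod_ord A. |H| <o |G| \<longrightarrow> bounded_mod A J H"
    and reg: "regular_cardinal |G|" and vG: "|{..<v}| <o |G|"
  shows "bounded_mod A J G"
proof -
  have inf: "infinite G"
    using regular_cardinal_infinite[OF reg] by (simp add: Field_card_of)
  have idJ: "ideal_on A J" using J by (rule admissible_ideal)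
  obtain f where f: "\<And>x. x \<in> G \<Longrightarrow> f x \<in> prod_ord A" "\<And>x. x \<in> G \<Longrightarrow> less_mod A J x (f x)"
    "\<And>x y. x \<in> G \<Longrightarrow> (y, x) \<in> |G| \<Longrightarrow> y \<noteq> x \<Longrightarrow> less_mod A J (f y) (f x)"
    using increasing_sequence[OF J G inf small] by blast
  show ?thesis
  proof (rule ccontr)
    assume unb: "\<not> bounded_mod A J G"
    have "|f ` G| <o \<mu>" using lam card_of_image ordLeq_ordLess_trans by blast
    then have fG: "f ` G \<subseteq> prod_ord A" "|f ` G| <o \<mu>" using f(1) by auto
    define Q where "Q g x J' g' \<longleftrightarrow> x \<in> G \<and> admissible J' \<and> J \<subseteq> J' \<and> {a\<in>A. f x a < g a} \<in> J' \<and>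
        g' \<in> prod_ord A \<and> (\<forall>y\<in>G. less_mod A J' (f y) g')"
      for g x J' g'
    have "\<exists>x J' g'. Q g x J' g'" if g: "g \<in> prod_ord A" for g
    proof -
      \<comment> \<open>A \<open>g\<close> above every \<open>f x\<close> would bound
        \<open>G\<close>, since each \<open>x\<close> lies below \<open>f x\<close>.\<close>
      obtain x where x: "x \<in> G" "\<not> less_mod A J (f x) g"
        using unb f(2) less_mod_trans[OF idJ] g unfolding bounded_mod_def by meson
      let ?X = "{a\<in>A. \<not> f x a < g a}"
      have "?X \<notin> J" using x(2) unfolding less_mod_def by simp
      then obtain J' where "admissible J'" "J \<subseteq> J'" "A - ?X \<in> J'" "bounded_mod A J' (f ` G)"
        using loc[rule_format, of ?X "f ` G"] fG by auto
      moreover have "A - ?X = {a\<in>A. f x a < g a}" by auto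
      ultimately show ?thesis using x(1) unfolding Q_def bounded_mod_def by auto
    qed
    then obtain x J' g' where "\<And>g. g \<in> prod_ord A \<Longrightarrow> Q g (x g) (J' g) (g' g)"
      by metis
    then have x: "\<And>g. g \<in> prod_ord A \<Longrightarrow> x g \<in> G"
      and J': "\<And>g. g \<in> prod_ord A \<Longrightarrow> admissible (J' g)" "\<And>g. g \<in> prod_ord A \<Longrightarrow> J \<subseteq> J' g"
        "\<And>g. g \<in> prod_ord A \<Longrightarrow> {a\<in>A. f (x g) a < g a} \<in> J' g"
      and g': "\<And>g. g \<in> prod_ord A \<Longrightarrow> g' g \<in> prod_ord A"
        "\<And>g y. g \<in> prod_ord A \<Longrightarrow> y \<in> G \<Longrightarrow> less_mod A (J' g) (f y) (g' g)"
      unfolding Q_def by blast+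
    have "\<exists>s. \<forall>\<alpha><v. \<forall>i\<in>{()}. s \<alpha> i \<in> prod_ord A \<and>
        (\<forall>\<beta><\<alpha>. \<forall>a\<in>T. (\<lambda>_. g' (s \<beta> ())) i a < s \<alpha> i a)"
      using iterate_steps[of "{()}" "\<lambda>s _. g' (s ())"] g'(1) by simp
    then obtain s0 where s0: "\<forall>\<alpha><v. s0 \<alpha> () \<in> prod_ord A \<and>
        (\<forall>\<beta><\<alpha>. \<forall>a\<in>T. g' (s0 \<beta> ()) a < s0 \<alpha> () a)"
      by auto
    define s where "s \<alpha> = s0 \<alpha> ()" for \<alpha>
    have s: "\<And>\<alpha>. \<alpha> < v \<Longrightarrow> s \<alpha> \<in> prod_ord A"
      and lt: "\<And>\<alpha> \<beta> a. \<alpha> < v \<Longrightarrow> \<beta> < \<alpha> \<Longrightarrow> a \<in> T \<Longrightarrow> g' (s \<beta>) a < s \<alpha> a"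
      using s0 by (auto simp: s_def)
    obtain k where k: "k \<in> G" "\<And>\<alpha>. \<alpha> < v \<Longrightarrow> (x (s \<alpha>), k) \<in> |G|"
      using index_bound[OF reg vG, of "\<lambda>\<alpha>. x (s \<alpha>)"] x s by (auto simp: Field_card_of)
    \<comment> \<open>At this point \<open>f k\<close> is caught between stage \<alpha> and its
      improvement, which all later stages exceed. So no point serves two stages.\<close>
    have "\<exists>a\<in>T. s \<alpha> a \<le> f k a \<and> f k a < g' (s \<alpha>) a" if \<alpha>: "\<alpha> < v" for \<alpha>
    proof -
      have id: "ideal_on A (J' (s \<alpha>))" and AT: "A - T \<in> J' (s \<alpha>)"
        using J'(1)[OF s[OF \<alpha>]] unfolding admissible_def by auto
      have "{a\<in>A. \<not> f (x (s \<alpha>)) a \<le> f k a} \<in> J"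
      proof (cases "x (s \<alpha>) = k")
        case True
        then show ?thesis using idJ unfolding ideal_on_def by simp
      next
        case False
        then show ?thesis
          using f(3)[OF k(1) k(2)[OF \<alpha>]] less_imp_le_mod[OF idJ] unfolding le_mod_def by blast
      qed
      then have "(A - T) \<union> {a\<in>A. \<not> f (x (s \<alpha>)) a \<le> f k a} \<in> J' (s \<alpha>)"
        using J'(2)[OF s[OF \<alpha>]] AT ideal_onD(4)[OF id] by blast
      moreover note J'(3)[OF s[OF \<alpha>]]
      moreover have "{a\<in>A. \<not> f k a < g' (s \<alpha>) a} \<in> J' (s \<alpha>)"
        using g'(2)[OF s[OF \<alpha>] k(1)] unfolding less_mod_def .
      ultimately obtain a where "a \<in> A" "a \<notin> (A - T) \<union> {a\<in>A. \<not> f (x (s \<alpha>)) a \<le> f k a}"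
          "a \<notin> {a\<in>A. f (x (s \<alpha>)) a < s \<alpha> a}" "a \<notin> {a\<in>A. \<not> f k a < g' (s \<alpha>) a}"
        using ideal_on_ex_notin[OF id] by meson
      then show ?thesis by (auto simp: not_less intro: order_trans)
    qed
    then obtain y where y: "\<And>\<alpha>. \<alpha> < v \<Longrightarrow> y \<alpha> \<in> T" "\<And>\<alpha>. \<alpha> < v \<Longrightarrow> s \<alpha> (y \<alpha>) \<le> f k (y \<alpha>)"
      "\<And>\<alpha>. \<alpha> < v \<Longrightarrow> f k (y \<alpha>) < g' (s \<alpha>) (y \<alpha>)"
      by metis
    have "y \<alpha> \<noteq> y \<beta>" if "\<alpha> < \<beta>" "\<beta> < v" for \<alpha> \<beta>
    proof
      assume eq: "y \<alpha> = y \<beta>"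
      have \<alpha>: "\<alpha> < v" using that by (rule less_trans)
      have "f k (y \<alpha>) < g' (s \<alpha>) (y \<alpha>)" using y(3) \<alpha> by blast
      also have "\<dots> < s \<beta> (y \<alpha>)" using lt that y(1)[OF \<alpha>] by blast
      finally show False using y(2)[OF that(2)] eq by simp
    qed
    then show False using no_injection[of y] y(1) by blast
  qed
qed

text \<open>Induction on \<open>|G|\<close>. Finite families and those of size at most
  \<open>|{..<v}|\<close> have direct bounds; the other cases split by regularity of
  \<open>|G|\<close>.\<close>

lemma directed_mod:
  fixes \<mu> :: "('a \<Rightarrow> 'a) rel"
  assumes J: "admissible J"
    and loc: "\<forall>X\<subseteq>A. X \<notin> J \<longrightarrow> (\<forall>H\<subseteq>prod_ord A. |H| <o \<mu> \<longrightarrow>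
      (\<exists>J'. admissible J' \<and> J \<subseteq> J' \<and> A - X \<in> J' \<and> bounded_mod A J' H))"
  shows "G \<subseteq> prod_ord A \<Longrightarrow> |G| <o \<mu> \<Longrightarrow> bounded_mod A J G"
proof (induction G rule: wf_induct[OF wf_inv_image[OF wf_ordLess, of card_of]])
  case (1 G)
  note G = \<open>G \<subseteq> prod_ord A\<close> and lam = \<open>|G| <o \<mu>\<close>
  have small: "\<forall>H\<subseteq>prod_ord A. |H| <o |G| \<longrightarrow> bounded_mod A J H"
  proof (intro allI impI)
    fix H assume H: "H \<subseteq> prod_ord A" "|H| <o |G|"
    have "(H, G) \<in> inv_image ordLess card_of" using H(2) by simp
    moreover have "|H| <o \<mu>" using H(2) lam by (rule ordLess_transitive)
    ultimately show "bounded_mod A J H" using "1.IH" H(1) by blast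
  qed
  show ?case
  proof (cases "finite G \<or> |G| \<le>o |{..<v}| \<or> \<not> regularCard |G|")
    case True
    then show ?thesis
      using finite_bounded_mod[OF J G] small_bounded_mod[OF J G]
        singular_bounded_mod[OF J G _ small] by satx
  next
    case False
    then have vG: "|{..<v}| <o |G|"
      using ordLess_or_ordLeq[OF card_of_Well_order card_of_Well_order] by blast
    have reg: "regular_cardinal |G|"
      using False regular_cardinal_card_of by blast
    show ?thesis
      by (rule regular_bounded_mod[OF J loc G lam small reg vG])
  qed
qed

end

section \<open>Ideals closed under small unions\<close>

text \<open>As \<sigma> is infinite, completeness covers finite unions, including the empty
  one.\<close>

lemma complete_ideal_onI:
  assumes "regular_cardinal \<sigma>" "complete_ideal \<sigma> J" "J \<subseteq> Pow A" "A \<notin> J"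
    and down: "\<And>X Y. X \<in> J \<Longrightarrow> Y \<subseteq> X \<Longrightarrow> Y \<in> J"
  shows "ideal_on A J"
proof -
  have fin: "\<Union>S \<in> J" if "S \<subseteq> J" "finite S" for S
    using that(1) assms(2) finite_ordLess_regular[OF that(2) assms(1)]
    by (simp add: complete_ideal_def)
  have "X \<union> Y \<in> J" if "X \<in> J" "Y \<in> J" for X Y
    using fin[of "{X, Y}"] that by simp
  moreover have "{} \<in> J" using fin[of "{}"] by simp
  ultimately show ?thesis
    unfolding ideal_on_def by (intro conjI ballI allI impI assms(3,4)) (use down in auto)
qed

lemma complete_idealD:
  assumes "complete_ideal \<sigma> J" "|I| <o \<sigma>" "\<And>i. i \<in> I \<Longrightarrow> X i \<in> J"
  shows "(\<Union>i\<in>I. X i) \<in> J"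
proof -
  have "|X ` I| <o \<sigma>" using card_of_image assms(2) ordLeq_ordLess_trans by blast
  moreover have "X ` I \<subseteq> J" using assms(3) by blast
  ultimately show ?thesis using assms(1) by (simp add: complete_ideal_def)
qed

text \<open>For an ideal \<open>J\<close> on \<open>A\<close> and \<open>X\<close> contained in
  \<open>A\<close>, this is the ideal generated by \<open>J\<close> and
  \<open>A - X\<close>.\<close>

lemma complete_ideal_restrict:
  assumes "complete_ideal \<sigma> J"
  shows "complete_ideal \<sigma> {Y. Y \<subseteq> A \<and> Y \<inter> X \<in> J}"
  unfolding complete_ideal_def
proof (intro allI impI)
  fix S assume S: "S \<subseteq> {Y. Y \<subseteq> A \<and> Y \<inter> X \<in> J} \<and> |S| <o \<sigma>"
  then have "(\<Union>Y\<in>S. Y \<inter> X) \<in> J"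
    by (intro complete_idealD[OF assms, of S]) auto
  moreover have "(\<Union>Y\<in>S. Y \<inter> X) = \<Union>S \<inter> X" by blast
  ultimately show "\<Union>S \<in> {Y. Y \<subseteq> A \<and> Y \<inter> X \<in> J}" using S by auto
qed

section \<open>Extending an ideal until the true cofinality exists\<close>

context progressive_tail
begin

text \<open>Completeness would absorb \<open>T\<close> if all its singletons were null. A positive
  singleton \<open>{a}\<close> gives a principal ultrafilter, modulo which the product looks like
  \<open>a\<close> itself.\<close>

lemma tcf_extension_of_small_tail:
  assumes \<sigma>: "regular_cardinal \<sigma>" and J: "admissible J" "complete_ideal \<sigma> J"
    and small: "|T| <o \<sigma>"
  shows "\<exists>J' (\<kappa> :: ('a \<Rightarrow> 'a) rel). J \<subseteq> J' \<and> ideal_on A J' \<and> complete_ideal \<sigma> J' \<and> has_tcf A J' \<kappa>"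
proof -
  have idJ: "ideal_on A J" and AT: "A - T \<in> J" using J(1) unfolding admissible_def by auto
  have "\<exists>a\<in>T. {a} \<notin> J"
  proof (rule ccontr)
    assume "\<not> ?thesis"
    then have "(\<Union>a\<in>T. {a}) \<in> J" by (intro complete_idealD[OF J(2) small]) auto
    then have "A \<in> J" using ideal_on_subset_Un[OF idJ AT, of T A] by auto
    then show False using ideal_onD(1)[OF idJ] by blast
  qed
  then obtain a where a: "a \<in> A" "{a} \<notin> J" using T_subset by blast
  let ?J = "Pow (A - {a})"
  have id: "ideal_on A ?J" using a(1) unfolding ideal_on_def by auto
  have sub: "J \<subseteq> ?J"
  proof
    fix X assume X: "X \<in> J"
    then have "a \<notin> X" using a(2) ideal_onD(3)[OF idJ X, of "{a}"] by blast
    then show "X \<in> ?J" using ideal_onD(2)[OF idJ X] by blast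
  qed
  have comp: "complete_ideal \<sigma> ?J" unfolding complete_ideal_def by blast
  obtain g where g: "g \<in> prod_ord A" using prod_ord_nonempty by blast
  \<comment> \<open>Only the value at \<open>a\<close> matters; \<open>g\<close> is a filler
    elsewhere.\<close>
  define f where "f i = (\<lambda>b\<in>A. if b = a then i else g b)" for i
  have "has_tcf A ?J (ord_rel a)"
    unfolding has_tcf_def
  proof (intro conjI regular_ord a(1) exI[of _ f] ballI allI impI)
    fix i assume "i \<in> Field (ord_rel a)"
    then show "f i \<in> prod_ord A"
      using g by (auto simp: Field_ord_rel f_def prod_ord_def PiE_iff)
  next
    fix i j assume "(i, j) \<in> ord_rel a \<and> i \<noteq> j"
    then show "less_mod A ?J (f i) (f j)"
      using a(1) by (auto simp: ord_rel_def less_mod_def f_def)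
  next
    fix h assume h: "h \<in> prod_ord A"
    have "h a \<in> Field (ord_rel a)" using prod_ord_less[OF h a(1)] by (simp add: Field_ord_rel)
    moreover have "le_mod A ?J h (f (h a))" by (auto simp: le_mod_def f_def)
    ultimately show "\<exists>i\<in>Field (ord_rel a). le_mod A ?J h (f i)" by blast
  qed
  then obtain \<kappa> :: "('a \<Rightarrow> 'a) rel" where "has_tcf A ?J \<kappa>"
    using has_tcf_transfer[OF id] by blast
  then show ?thesis using sub id comp by blast
qed

text \<open>The minimal unbounded family supplies the length of the cofinal sequence. Largeness of
  \<open>T\<close> makes this length at least \<sigma>, which keeps the auxiliary ideal
  \<sigma>-complete.\<close>

lemma tcf_extension_of_large_tail:
  assumes \<sigma>: "regular_cardinal \<sigma>" and J0: "admissible J0" "complete_ideal \<sigma> J0"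
    and large: "\<sigma> \<le>o |T|"
  shows "\<exists>J (\<kappa> :: ('a \<Rightarrow> 'a) rel). J0 \<subseteq> J \<and> ideal_on A J \<and> complete_ideal \<sigma> J \<and> has_tcf A J \<kappa>"
proof -
  define ext where "ext J \<longleftrightarrow> ideal_on A J \<and> complete_ideal \<sigma> J \<and> J0 \<subseteq> J" for J
  define wit where "wit J F \<longleftrightarrow> ext J \<and> F \<subseteq> prod_ord A \<and>
    (\<forall>J'. ext J' \<and> J \<subseteq> J' \<longrightarrow> \<not> bounded_mod A J' F)" for J F
  have adm: "admissible J" if "ext J" for J
    using that J0(1) unfolding ext_def admissible_def by blast
  \<comment> \<open>The whole product is a first witness: a bound for it would be strictly below
    itself.\<close>
  have "\<not> bounded_mod A J (prod_ord A)" if "ext J" for J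
    using that less_mod_irrefl unfolding ext_def bounded_mod_def by blast
  then have "wit J0 (prod_ord A)"
    using J0 unfolding wit_def ext_def admissible_def by blast
  then have "\<exists>r\<in>{ |F| |F. \<exists>J. wit J F}. \<forall>r'\<in>{ |F| |F. \<exists>J. wit J F}. r \<le>o r'"
    by (intro exists_minim_Card_order) (auto intro: card_of_Card_order)
  then obtain J F where w: "wit J F" and min: "\<And>J' F'. wit J' F' \<Longrightarrow> |F| \<le>o |F'|"
    by blast
  have eJ: "ext J" and F: "F \<subseteq> prod_ord A"
    and unb: "\<And>J'. ext J' \<Longrightarrow> J \<subseteq> J' \<Longrightarrow> \<not> bounded_mod A J' F"
    using w unfolding wit_def by blast+
  have J: "admissible J" and idJ: "ideal_on A J" and comp: "complete_ideal \<sigma> J" and J0J: "J0 \<subseteq> J"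
    using eJ adm unfolding ext_def by blast+
  have emp: "{} \<in> J" using idJ unfolding ideal_on_def by blast
  \<comment> \<open>By minimality \<open>H\<close> is no witness over the ideal generated by
    \<open>J\<close> and \<open>A - X\<close>, so some extension of that ideal bounds it.\<close>
  have "\<exists>J'. admissible J' \<and> J \<subseteq> J' \<and> A - X \<in> J' \<and> bounded_mod A J' H"
    if X: "X \<subseteq> A" "X \<notin> J" and H: "H \<subseteq> prod_ord A" "|H| <o |F|" for X H
  proof -
    let ?J = "{Y. Y \<subseteq> A \<and> Y \<inter> X \<in> J}"
    have JJ: "J \<subseteq> ?J"
    proof
      fix Y assume Y: "Y \<in> J"
      then have "Y \<inter> X \<in> J" by (rule ideal_onD(3)[OF idJ]) blast
      then show "Y \<in> ?J" using ideal_onD(2)[OF idJ Y] by blast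
    qed
    have "A \<inter> X = X" using X(1) by blast
    then have notA: "A \<notin> ?J" using X(2) by auto
    have "ideal_on A ?J"
    proof (rule complete_ideal_onI[OF \<sigma> complete_ideal_restrict[OF comp] _ notA])
      fix Y Z assume Y: "Y \<in> ?J" and Z: "Z \<subseteq> Y"
      then have "Z \<inter> X \<subseteq> Y \<inter> X" by blast
      then show "Z \<in> ?J" using Y Z ideal_onD(3)[OF idJ] by blast
    qed auto
    then have eJ': "ext ?J"
      using complete_ideal_restrict[OF comp] JJ J0J unfolding ext_def by blast
    have "\<not> wit ?J H" using min[of ?J H] not_ordLess_ordLeq[OF H(2)] by blast
    then have "\<exists>J'. ext J' \<and> ?J \<subseteq> J' \<and> bounded_mod A J' H"
      using eJ' H(1) by (simp add: wit_def)
    then obtain J' where J': "ext J'" "?J \<subseteq> J'" "bounded_mod A J' H"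
      by (elim exE conjE)
    have "(A - X) \<inter> X = {}" by blast
    then have "A - X \<in> ?J" using emp by simp
    then show ?thesis using J' adm[OF J'(1)] JJ by (intro exI[of _ J']) auto
  qed
  then have loc: "\<forall>X\<subseteq>A. X \<notin> J \<longrightarrow> (\<forall>H\<subseteq>prod_ord A. |H| <o |F| \<longrightarrow>
      (\<exists>J'. admissible J' \<and> J \<subseteq> J' \<and> A - X \<in> J' \<and> bounded_mod A J' H))"
    by simp
  have small: "\<forall>H\<subseteq>prod_ord A. |H| <o |F| \<longrightarrow> bounded_mod A J H"
    using directed_mod[OF J loc] by simp
  have unbF: "\<not> bounded_mod A J F" using unb eJ by blast
  have inf: "infinite F" using finite_bounded_mod[OF J F] unbF by blast
  have reg: "regular_cardinal |F|"
    using singular_bounded_mod[OF J F inf small] unbF regular_cardinal_card_of[OF inf] by blast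
  have vF: "|{..<v}| <o |F|"
    using small_bounded_mod[OF J F] unbF
      ordLess_or_ordLeq[OF card_of_Well_order card_of_Well_order] by blast
  have \<sigma>F: "\<sigma> \<le>o |F|"
    using ordLeq_ordLess_trans[OF large ordLess_transitive[OF T_less vF]]
    by (rule ordLess_imp_ordLeq)
  obtain f where f: "\<And>x. x \<in> F \<Longrightarrow> f x \<in> prod_ord A" "\<And>x. x \<in> F \<Longrightarrow> less_mod A J x (f x)"
    "\<And>x y. x \<in> F \<Longrightarrow> (y, x) \<in> |F| \<Longrightarrow> y \<noteq> x \<Longrightarrow> less_mod A J (f y) (f x)"
    using increasing_sequence[OF J F inf small] by blast
  have "\<exists>x\<in>F. le_mod A J g (f x)" if g: "g \<in> prod_ord A" for g
  proof (rule ccontr)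
    assume no: "\<not> ?thesis"
    define X where "X x = {a\<in>A. \<not> g a \<le> f x a}" for x
    have XJ: "X x \<notin> J" if "x \<in> F" for x
      using no that unfolding le_mod_def X_def by blast
    \<comment> \<open>The sets \<open>X x\<close> decrease modulo \<open>J\<close> along
      \<open>|F|\<close>, because \<open>f\<close> increases.\<close>
    have X_mono: "Y \<inter> X y \<in> J" if "Y \<inter> X x \<in> J" "(x, y) \<in> |F|" "y \<in> F" for Y x y
    proof (cases "x = y")
      case False
      have "{a\<in>A. \<not> f x a < f y a} \<in> J"
        using f(3)[OF that(3,2) False] unfolding less_mod_def .
      then show ?thesis
        by (rule ideal_on_subset_Un[OF idJ that(1)]) (auto simp: X_def)
    qed (use that in simp)
    \<comment> \<open>The sets that are null on some \<open>X x\<close>. For fewer than \<sigma> of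
      them a common index \<open>k\<close> exists by regularity of \<open>|F|\<close>.\<close>
    let ?J = "{Y. Y \<subseteq> A \<and> (\<exists>x\<in>F. Y \<inter> X x \<in> J)}"
    have comp': "complete_ideal \<sigma> ?J"
      unfolding complete_ideal_def
    proof (intro allI impI, elim conjE)
      fix S assume S: "S \<subseteq> ?J" "|S| <o \<sigma>"
      then obtain x where x: "\<And>Y. Y \<in> S \<Longrightarrow> x Y \<in> F" "\<And>Y. Y \<in> S \<Longrightarrow> Y \<inter> X (x Y) \<in> J"
        using bchoice[of S "\<lambda>Y x. x \<in> F \<and> Y \<inter> X x \<in> J"] by blast
      have "|x ` S| <o |F|"
        by (rule ordLess_ordLeq_trans[OF ordLeq_ordLess_trans[OF card_of_image S(2)] \<sigma>F])
      moreover have "x ` S \<subseteq> Field |F|" using x(1) by (auto simp: Field_card_of)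
      ultimately obtain k where "k \<in> Field |F|" "\<forall>y\<in>x ` S. (y, k) \<in> |F|"
        using regular_cardinal_bounded[OF reg] by blast
      then have k: "k \<in> F" "\<And>Y. Y \<in> S \<Longrightarrow> (x Y, k) \<in> |F|"
        by (auto simp: Field_card_of)
      have "(\<Union>Y\<in>S. Y \<inter> X k) \<in> J"
        using X_mono x k by (intro complete_idealD[OF comp S(2)]) blast
      moreover have "(\<Union>Y\<in>S. Y \<inter> X k) = \<Union>S \<inter> X k" by blast
      ultimately show "\<Union>S \<in> ?J" using S(1) k(1) by auto
    qed
    obtain x0 where x0: "x0 \<in> F" using inf by (metis finite.emptyI equals0I)
    have JJ: "J \<subseteq> ?J"
    proof
      fix Y assume Y: "Y \<in> J"
      then have "Y \<inter> X x0 \<in> J" by (rule ideal_onD(3)[OF idJ]) blast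
      then show "Y \<in> ?J" using x0 ideal_onD(2)[OF idJ Y] by blast
    qed
    have "A \<inter> X x = X x" for x unfolding X_def by blast
    then have notA: "A \<notin> ?J" using XJ by auto
    have "ideal_on A ?J"
    proof (rule complete_ideal_onI[OF \<sigma> comp'])
      fix Y Z assume Y: "Y \<in> ?J" and Z: "Z \<subseteq> Y"
      then obtain x where "x \<in> F" "Y \<inter> X x \<in> J" by blast
      moreover have "Z \<inter> X x \<subseteq> Y \<inter> X x" using Z by blast
      ultimately show "Z \<in> ?J" using Y Z ideal_onD(3)[OF idJ] by blast
    qed (use notA in auto)
    then have e: "ext ?J" and id': "ideal_on A ?J" using comp' JJ J0J unfolding ext_def by auto
    \<comment> \<open>On \<open>X x\<close> the function \<open>g\<close> exceeds
      \<open>f x\<close>, so it bounds \<open>F\<close> modulo \<open>?J\<close>, against the choice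
      of \<open>F\<close>.\<close>
    have "less_mod A ?J x g" if x: "x \<in> F" for x
    proof -
      have "{a\<in>A. \<not> f x a < g a} \<inter> X x = {}" by (auto simp: X_def)
      then have "{a\<in>A. \<not> f x a < g a} \<inter> X x \<in> J" using emp by simp
      then have "{a\<in>A. \<not> f x a < g a} \<in> ?J" using x by blast
      then have "less_mod A ?J (f x) g" unfolding less_mod_def .
      then show ?thesis
        using less_mod_trans[OF id' less_mod_mono[OF f(2)[OF x] JJ]] by blast
    qed
    then have "bounded_mod A ?J F" using g unfolding bounded_mod_def by blast
    then show False using unb[OF e JJ] by blast
  qed
  then have "has_tcf A J |F|"
    unfolding has_tcf_def Field_card_of
  proof (intro conjI reg exI[of _ f] ballI allI impI, goal_cases)
    case (2 x y)
    then have "y \<in> F" using FieldI2[of x y "|F|"] by (simp add: Field_card_of)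
    then show ?case using f(3) 2 by blast
  qed (use f(1) in auto)
  then show ?thesis using J0J idJ comp by blast
qed

lemma tcf_extension:
  assumes \<sigma>: "regular_cardinal \<sigma>" and J: "admissible J" "complete_ideal \<sigma> J"
  shows "\<exists>J' (\<kappa> :: ('a \<Rightarrow> 'a) rel). J \<subseteq> J' \<and> ideal_on A J' \<and> complete_ideal \<sigma> J' \<and> has_tcf A J' \<kappa>"
  using tcf_extension_of_small_tail[OF assms] tcf_extension_of_large_tail[OF assms]
    ordLess_or_ordLeq[OF card_of_Well_order regular_cardinal_Well_order[OF \<sigma>]] by blast

end

section \<open>The ideal of bounded sets and the choice of a tail\<close>

lemma J_bd_subset: "X \<in> J_bd A \<Longrightarrow> Y \<subseteq> X \<Longrightarrow> Y \<in> J_bd A"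
  unfolding J_bd_def by blast

lemma Int_lessThan_in_J_bd: "z \<in> sup_ord A \<Longrightarrow> A \<inter> {..<z} \<in> J_bd A"
  unfolding J_bd_def by blast

text \<open>If \<open>a\<close> is the maximum of \<open>A\<close>, it is not itself in
  \<open>sup_ord A\<close>. Progressivity and regularity of \<open>a\<close> give a bound below
  \<open>a\<close>.\<close>

lemma initial_segment_in_J_bd:
  assumes A: "regular_cardinals A" "progressive A" and a: "a \<in> A"
  shows "A \<inter> {..<a} \<in> J_bd A"
proof -
  have "(LEAST a. a \<in> A) \<le> a" using a by (rule Least_le)
  then have "|{..<(LEAST a. a \<in> A)}| \<le>o |{..<a}|" by (intro card_of_mono1) auto
  moreover have "|A| <o |{..<(LEAST a. a \<in> A)}|" using A(2) unfolding progressive_def by blast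
  ultimately have "|A| <o |{..<a}|" using ordLess_ordLeq_trans by blast
  then have "|A \<inter> {..<a}| <o |{..<a}|"
    using card_of_mono1[of "A \<inter> {..<a}" A] ordLeq_ordLess_trans by blast
  then obtain y where "y < a" "\<forall>x\<in>A \<inter> {..<a}. x < y"
    using regular_ord_strictly_bounded[of a "A \<inter> {..<a}"] A(1) a
    unfolding regular_cardinals_def by auto
  then show ?thesis using a unfolding J_bd_def sup_ord_def by auto
qed

text \<open>If \<open>A\<close> has a maximum, it alone is a tail, and any \<open>v\<close> below it
  with two predecessors will do. Otherwise the minimum serves as \<open>v\<close> and is dropped
  from \<open>A\<close>, since \<open>v\<close> must lie strictly below the tail.\<close>

lemma progressive_tail_exists:
  assumes A: "regular_cardinals A" "progressive A"
  shows "\<exists>T v. progressive_tail A T v \<and> A - T \<in> J_bd A"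
proof (cases "\<exists>m\<in>A. \<forall>a\<in>A. a \<le> m")
  case True
  then obtain m where m: "m \<in> A" "\<forall>a\<in>A. a \<le> m" by blast
  have reg: "regular_cardinal (ord_rel m)" using A(1) m(1) unfolding regular_cardinals_def by blast
  then have "{..<m} \<noteq> {}" using regular_cardinal_infinite[OF reg] by (auto simp: Field_ord_rel)
  then obtain x where "x < m" by blast
  then obtain y where y: "x < y" "y < m" using regular_cardinal_ord_rel_limit[OF reg] by blast
  then obtain v where v: "y < v" "v < m" using regular_cardinal_ord_rel_limit[OF reg] by blast
  have "\<not> |{..<v}| \<le>o |{m}|"
  proof
    assume "|{..<v}| \<le>o |{m}|"
    then obtain f where "inj_on f {..<v}" "f ` {..<v} \<subseteq> {m}" using card_of_ordLeq by metis
    moreover have "x \<in> {..<v}" "y \<in> {..<v}" using y v by auto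
    ultimately have "x = y" unfolding inj_on_def by blast
    then show False using y by simp
  qed
  then have "|{m}| <o |{..<v}|"
    using ordLess_or_ordLeq[OF card_of_Well_order card_of_Well_order] by blast
  then have "progressive_tail A {m} v"
    using A(1) m(1) v by unfold_locales auto
  moreover have "A - {m} = A \<inter> {..<m}" using m(2) by auto
  ultimately show ?thesis using initial_segment_in_J_bd[OF A m(1)] by auto
next
  case False
  let ?m = "LEAST a. a \<in> A"
  have ne: "A \<noteq> {}" and small: "|A| <o |{..<?m}|" using A(2) unfolding progressive_def by auto
  have m: "?m \<in> A" using ne by (metis LeastI equals0I)
  obtain a where a: "a \<in> A" "?m < a" using False m by (meson not_le)
  have "|A - {?m}| <o |{..<?m}|"
    using card_of_mono1[of "A - {?m}" A] small ordLeq_ordLess_trans by blast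
  moreover have "?m < b" if "b \<in> A - {?m}" for b
    using that Least_le[of "\<lambda>a. a \<in> A" b] by auto
  ultimately have "progressive_tail A (A - {?m}) ?m"
    using A(1) by unfold_locales auto
  moreover have "{?m} \<in> J_bd A"
  proof -
    \<comment> \<open>\<open>a\<close> bounds \<open>{?m}\<close>, and the larger \<open>b\<close>
      puts \<open>a\<close> into \<open>sup_ord A\<close>.\<close>
    obtain b where "b \<in> A" "a < b" using False a(1) by (meson not_le)
    then show ?thesis using a m unfolding J_bd_def sup_ord_def by auto
  qed
  moreover have "A - (A - {?m}) = {?m}" using m by blast
  ultimately show ?thesis by metis
qed

text \<open>Fewer than \<sigma> proper initial segments cannot cover \<open>A\<close>, as their
  union lies in the proper ideal \<open>J\<close>. A point left out bounds the union. This is how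
  nonemptiness of the pcf set enters.\<close>

lemma J_bd_complete:
  assumes A: "regular_cardinals A" "progressive A"
    and J: "ideal_on A J" "complete_ideal \<sigma> J" "J_bd A \<subseteq> J"
  shows "complete_ideal \<sigma> (J_bd A)"
  unfolding complete_ideal_def
proof (intro allI impI, elim conjE)
  fix S assume S: "S \<subseteq> J_bd A" "|S| <o \<sigma>"
  then have "\<forall>X\<in>S. \<exists>z. z \<in> sup_ord A \<and> X \<subseteq> {..<z}" unfolding J_bd_def by blast
  then obtain z where z: "\<And>X. X \<in> S \<Longrightarrow> z X \<in> sup_ord A" "\<And>X. X \<in> S \<Longrightarrow> X \<subseteq> {..<z X}"
    by metis
  have "A \<inter> {..<z X} \<in> J" if "X \<in> S" for X
    using J(3) Int_lessThan_in_J_bd[OF z(1)[OF that]] by (rule subsetD)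
  then have "(\<Union>X\<in>S. A \<inter> {..<z X}) \<in> J" by (rule complete_idealD[OF J(2) S(2)])
  then have "\<not> A \<subseteq> (\<Union>X\<in>S. A \<inter> {..<z X})"
    using ideal_onD(1,3)[OF J(1)] by metis
  then have "\<exists>a\<in>A. \<forall>X\<in>S. \<not> a < z X" by blast
  then obtain a where a: "a \<in> A" "\<And>X. X \<in> S \<Longrightarrow> z X \<le> a" by (auto simp: not_less)
  have "\<Union>S \<subseteq> A \<inter> {..<a}"
  proof
    fix b assume "b \<in> \<Union>S"
    then obtain X where X: "X \<in> S" "b \<in> X" by blast
    then have "b \<in> A" using S(1) unfolding J_bd_def by blast
    moreover have "b < a" using z(2)[OF X(1)] X(2) a(2)[OF X(1)] by auto
    ultimately show "b \<in> A \<inter> {..<a}" by simp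
  qed
  then show "\<Union>S \<in> J_bd A"
    by (rule J_bd_subset[OF initial_segment_in_J_bd[OF A a(1)]])
qed

section \<open>True cofinalities as lower bounds\<close>

lemma has_tcf_cong:
  assumes "has_tcf A J \<kappa>" "\<kappa> =o \<kappa>'"
  shows "has_tcf A J \<kappa>'"
proof -
  obtain f where reg: "regular_cardinal \<kappa>"
    and f: "\<And>i. i \<in> Field \<kappa> \<Longrightarrow> f i \<in> prod_ord A"
    and inc: "\<And>i j. (i, j) \<in> \<kappa> \<Longrightarrow> i \<noteq> j \<Longrightarrow> less_mod A J (f i) (f j)"
    and cof: "\<And>g. g \<in> prod_ord A \<Longrightarrow> \<exists>i\<in>Field \<kappa>. le_mod A J g (f i)"
    using assms(1) unfolding has_tcf_def by blast
  obtain h where "iso \<kappa>' \<kappa> h"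
    using ordIso_symmetric[OF assms(2)] unfolding ordIso_def by blast
  then have h: "bij_betw h (Field \<kappa>') (Field \<kappa>)"
    "\<And>i j. i \<in> Field \<kappa>' \<Longrightarrow> j \<in> Field \<kappa>' \<Longrightarrow> (i, j) \<in> \<kappa>' \<longleftrightarrow> (h i, h j) \<in> \<kappa>"
    by (auto simp: iso_iff2)
  show ?thesis
    unfolding has_tcf_def
  proof (intro conjI exI[of _ "f \<circ> h"] ballI allI impI; (elim conjE)?)
    show "regular_cardinal \<kappa>'" using regular_cardinal_cong[OF reg assms(2)] .
    show "(f \<circ> h) i \<in> prod_ord A" if "i \<in> Field \<kappa>'" for i
      using f h(1) that unfolding bij_betw_def by auto
    show "less_mod A J ((f \<circ> h) i) ((f \<circ> h) j)" if "(i, j) \<in> \<kappa>'" "i \<noteq> j" for i j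
    proof -
      have ij: "i \<in> Field \<kappa>'" "j \<in> Field \<kappa>'" using that(1) by (auto simp: Field_def)
      then have "h i \<noteq> h j" using h(1) that(2) unfolding bij_betw_def inj_on_def by blast
      then show ?thesis using inc[of "h i" "h j"] h(2)[OF ij] that(1) by simp
    qed
    show "\<exists>i\<in>Field \<kappa>'. le_mod A J g ((f \<circ> h) i)" if g: "g \<in> prod_ord A" for g
    proof -
      obtain i where "i \<in> Field \<kappa>" "le_mod A J g (f i)" using cof g by blast
      moreover have "Field \<kappa> = h ` Field \<kappa>'" using h(1) unfolding bij_betw_def by simp
      ultimately show ?thesis by auto
    qed
  qed
qed

lemma tcf_ordLeq_cofinal_family:
  assumes \<kappa>: "\<kappa> \<in> pcf_Gamma \<theta> \<sigma> A" and F: "theta_sigma_cofinal \<theta> \<sigma> A F"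
  shows "\<kappa> \<le>o |F|"
proof (rule ccontr)
  assume no: "\<not> ?thesis"
  obtain J B where J: "ideal_on A J" "complete_ideal \<sigma> J" "J_bd A \<subseteq> J"
    and B: "B \<subseteq> A" "A - B \<in> J" "|B| <o \<theta>" and tcf: "has_tcf A J \<kappa>"
    using \<kappa> unfolding pcf_Gamma_def by blast
  obtain f where reg: "regular_cardinal \<kappa>"
    and f: "\<And>i. i \<in> Field \<kappa> \<Longrightarrow> f i \<in> prod_ord A"
    and inc: "\<And>i j. (i, j) \<in> \<kappa> \<Longrightarrow> i \<noteq> j \<Longrightarrow> less_mod A J (f i) (f j)"
    and cof: "\<And>g. g \<in> prod_ord A \<Longrightarrow> \<exists>i\<in>Field \<kappa>. le_mod A J g (f i)"
    using tcf unfolding has_tcf_def by blast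
  have "|F| <o \<kappa>"
    using no ordLess_or_ordLeq[OF card_of_Well_order regular_cardinal_Well_order[OF reg]] by blast
  have "\<forall>h\<in>F. \<exists>i. i \<in> Field \<kappa> \<and> le_mod A J h (f i)"
  proof
    fix h assume "h \<in> F"
    then have "h \<in> prod_ord A" using F unfolding theta_sigma_cofinal_def by blast
    then show "\<exists>i. i \<in> Field \<kappa> \<and> le_mod A J h (f i)" using cof by blast
  qed
  then obtain i where i: "\<And>h. h \<in> F \<Longrightarrow> i h \<in> Field \<kappa>" "\<And>h. h \<in> F \<Longrightarrow> le_mod A J h (f (i h))"
    by metis
  have "|i ` F| <o \<kappa>" using card_of_image \<open>|F| <o \<kappa>\<close> by (rule ordLeq_ordLess_trans)
  moreover have "i ` F \<subseteq> Field \<kappa>" using i(1) by blast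
  ultimately have "\<exists>k\<in>Field \<kappa>. \<forall>x\<in>i ` F. (x, k) \<in> \<kappa>"
    using regular_cardinal_bounded[OF reg, of "i ` F"] by simp
  then obtain k where k: "k \<in> Field \<kappa>" "\<And>h. h \<in> F \<Longrightarrow> (i h, k) \<in> \<kappa>" by auto
  have le: "le_mod A J h (f k)" if h: "h \<in> F" for h
  proof (cases "i h = k")
    case False
    then have "less_mod A J (f (i h)) (f k)" using inc k(2)[OF h] by simp
    then show ?thesis
      using le_less_mod_trans[OF J(1) i(2)[OF h]] less_imp_le_mod[OF J(1)] by simp
  qed (use i(2)[OF h] in simp)
  \<comment> \<open>The covering property of \<open>F\<close> is tested on \<open>f k\<close>, which
    bounds all of \<open>F\<close> modulo \<open>J\<close>.\<close>
  have "restrict (f k) B \<in> prod_ord B"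
    using f[OF k(1)] B(1) by (auto simp: prod_ord_def PiE_iff)
  then have "\<exists>F0 z. F0 \<subseteq> F \<and> |F0| <o \<sigma> \<and> z \<in> sup_ord A \<and>
      (\<forall>b\<in>B - {..<z}. \<exists>h\<in>F0. restrict (f k) B b < h b)"
    using F[unfolded theta_sigma_cofinal_def, THEN conjunct2, THEN spec[of _ B],
        THEN spec[of _ "restrict (f k) B"]] B(1,3) by blast
  then obtain F0 z where F0: "F0 \<subseteq> F" "|F0| <o \<sigma>" and z: "z \<in> sup_ord A"
    and "\<forall>b\<in>B - {..<z}. \<exists>h\<in>F0. restrict (f k) B b < h b"
    by (elim exE conjE)
  then have cov: "\<And>b. b \<in> B \<Longrightarrow> \<not> b < z \<Longrightarrow> \<exists>h\<in>F0. f k b < h b"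
    by simp
  have "{a\<in>A. \<not> h a \<le> f k a} \<in> J" if "h \<in> F0" for h
    using le[of h] that F0(1) unfolding le_mod_def by auto
  then have "(\<Union>h\<in>F0. {a\<in>A. \<not> h a \<le> f k a}) \<in> J"
    by (rule complete_idealD[OF J(2) F0(2)])
  moreover have "A \<inter> {..<z} \<in> J" using J(3) Int_lessThan_in_J_bd[OF z] by (rule subsetD)
  \<comment> \<open>A point of \<open>B\<close> beyond \<open>z\<close> where no member of
    \<open>F0\<close> exceeds \<open>f k\<close>, contrary to the covering.\<close>
  ultimately have "\<exists>a\<in>A. a \<notin> A - B \<and> a \<notin> A \<inter> {..<z} \<and> a \<notin> (\<Union>h\<in>F0. {a\<in>A. \<not> h a \<le> f k a})"
    by (intro ideal_on_ex_notin[OF J(1) B(2)])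
  then obtain a where a: "a \<in> A" "a \<in> B" "\<not> a < z" "\<And>h. h \<in> F0 \<Longrightarrow> h a \<le> f k a" by auto
  then show False using cov[OF a(2,3)] by (auto simp: not_le[symmetric])
qed

section \<open>Universal families are cofinal\<close>

lemma ordLess_iso_underS:
  assumes S: "Card_order S" and \<kappa>: "Card_order \<kappa>" "\<kappa> <o S"
  shows "\<exists>x\<in>Field S. \<kappa> =o |underS S x|"
proof -
  have wo: "Well_order S" "Well_order \<kappa>"
    using S \<kappa>(1) card_order_on_well_order_on by blast+
  then obtain x where x: "x \<in> Field S" "\<kappa> =o Restr S (underS S x)"
    using ordLess_iff_ordIso_Restr \<kappa>(2) by blast
  have "Field (Restr S (underS S x)) = underS S x"
    using wo(1) wo_rel.underS_ofilter[of S x] Field_Restr_ofilter[of S] unfolding wo_rel_def by blast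
  then have "|Field \<kappa>| =o |underS S x|" using card_of_cong[OF x(2)] by simp
  then show ?thesis
    using x(1) card_of_Field_ordIso[OF \<kappa>(1)] ordIso_symmetric ordIso_transitive by blast
qed

context progressive_tail
begin

text \<open>There are at most \<open>S\<close> regular cardinals up to \<open>S\<close>, and each
  contributes a universal family of size at most \<open>S\<close>; the union has the right size and
  stays unbounded.\<close>

lemma universal_family_upto:
  fixes S :: "('a \<Rightarrow> 'a) rel"
  assumes S: "Cinfinite S"
  shows "\<exists>F\<subseteq>prod_ord A. |F| \<le>o S \<and>
    (\<forall>J (\<kappa> :: ('a \<Rightarrow> 'a) rel). admissible J \<and> has_tcf A J \<kappa> \<and> \<kappa> \<le>o S \<longrightarrow> \<not> bounded_mod A J F)"
proof -
  \<comment> \<open>Copies of all regular cardinals up to \<open>S\<close>; indexing by initial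
    segments of \<open>S\<close> bounds their number.\<close>
  define M where "M = {\<mu> \<in> {S} \<union> (\<lambda>x. |underS S x| ) ` Field S. regular_cardinal \<mu>}"
  have "\<forall>\<mu>\<in>M. \<exists>F. F \<subseteq> prod_ord A \<and> |F| \<le>o \<mu> \<and>
      (\<forall>J. admissible J \<and> has_tcf A J \<mu> \<longrightarrow> \<not> bounded_mod A J F)"
  proof
    fix \<mu> assume "\<mu> \<in> M"
    then have "regular_cardinal \<mu>" unfolding M_def by simp
    from universal_family[OF this] show "\<exists>F. F \<subseteq> prod_ord A \<and> |F| \<le>o \<mu> \<and>
      (\<forall>J. admissible J \<and> has_tcf A J \<mu> \<longrightarrow> \<not> bounded_mod A J F)" .
  qed
  then obtain U where U: "\<And>\<mu>. \<mu> \<in> M \<Longrightarrow> U \<mu> \<subseteq> prod_ord A" "\<And>\<mu>. \<mu> \<in> M \<Longrightarrow> |U \<mu>| \<le>o \<mu>"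
    "\<And>\<mu> J. \<mu> \<in> M \<Longrightarrow> admissible J \<Longrightarrow> has_tcf A J \<mu> \<Longrightarrow> \<not> bounded_mod A J (U \<mu>)"
    by metis
  have co: "Card_order S" and inf: "infinite (Field S)"
    using S unfolding cinfinite_def by auto
  have le: "\<mu> \<le>o S" if \<mu>: "\<mu> \<in> M" for \<mu>
  proof (cases "\<mu> = S")
    case True
    then show ?thesis using ordLeq_reflexive[OF card_order_on_well_order_on[OF co]] by simp
  next
    case False
    then obtain x where "x \<in> Field S" "\<mu> = |underS S x|" using \<mu> unfolding M_def by auto
    then show ?thesis using ordLess_imp_ordLeq[OF card_of_underS[OF co]] by simp
  qed
  have "|(\<lambda>x. |underS S x| ) ` Field S| \<le>o S"
    using card_of_image card_of_Field_ordIso[OF co] by (rule ordLeq_ordIso_trans)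
  moreover have "|{S}| \<le>o S"
    using inf by (intro Card_order_singl_ordLeq co) auto
  ultimately have "|{S} \<union> (\<lambda>x. |underS S x| ) ` Field S| \<le>o S"
    by (intro card_of_Un_ordLeq_infinite_Field[OF inf _ _ co])
  moreover have "M \<subseteq> {S} \<union> (\<lambda>x. |underS S x| ) ` Field S" unfolding M_def by blast
  ultimately have "|M| \<le>o S"
    using ordLeq_transitive[OF card_of_mono1] by simp
  moreover have "\<forall>\<mu>\<in>M. |U \<mu>| \<le>o S"
    using ordLeq_transitive[OF U(2) le] by simp
  ultimately have "|\<Union>\<mu>\<in>M. U \<mu>| \<le>o S"
    by (rule card_of_UNION_ordLeq_infinite_Field[OF inf co])
  moreover have "\<not> bounded_mod A J (\<Union>\<mu>\<in>M. U \<mu>)"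
    if J: "admissible J" and \<kappa>: "has_tcf A J \<kappa>" "\<kappa> \<le>o S" for J and \<kappa> :: "('a \<Rightarrow> 'a) rel"
  proof -
    have reg: "regular_cardinal \<kappa>" using \<kappa>(1) unfolding has_tcf_def by simp
    have "\<exists>\<mu>\<in>{S} \<union> (\<lambda>x. |underS S x| ) ` Field S. \<kappa> =o \<mu>"
    proof (cases "\<kappa> <o S")
      case True
      then show ?thesis
        using ordLess_iso_underS[OF co regular_cardinal_Card_order[OF reg]] by auto
    next
      case False
      then show ?thesis using \<kappa>(2) ordLeq_iff_ordLess_or_ordIso by auto
    qed
    then obtain \<mu> where "\<mu> \<in> M" "\<kappa> =o \<mu>"
      using regular_cardinal_cong[OF reg] unfolding M_def by auto
    then have "\<not> bounded_mod A J (U \<mu>)" "U \<mu> \<subseteq> (\<Union>\<mu>\<in>M. U \<mu>)"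
      using U(3)[OF _ J has_tcf_cong[OF \<kappa>(1)]] by auto
    then show ?thesis unfolding bounded_mod_def by blast
  qed
  ultimately show ?thesis using U(1) by (intro exI[of _ "\<Union>\<mu>\<in>M. U \<mu>"]) auto
qed

text \<open>If \<open>g\<close> on \<open>B\<close> defeats \<open>F\<close>, the sets on which
  fewer than \<sigma> members of \<open>F\<close> do cover \<open>g\<close> form a proper ideal, and
  \<open>g\<close> bounds \<open>F\<close> modulo it. An extension with a true cofinality
  contradicts \<open>unb\<close>.\<close>

lemma universal_family_cofinal:
  fixes \<sigma> :: "'s rel" and \<theta> :: "'t rel"
  assumes \<sigma>: "regular_cardinal \<sigma>" and tail: "A - T \<in> J_bd A"
    and bd: "complete_ideal \<sigma> (J_bd A)" and F: "F \<subseteq> prod_ord A"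
    and unb: "\<And>J \<kappa>. admissible J \<Longrightarrow> \<kappa> \<in> pcf_Gamma \<theta> \<sigma> A \<Longrightarrow> has_tcf A J \<kappa> \<Longrightarrow> \<not> bounded_mod A J F"
  shows "theta_sigma_cofinal \<theta> \<sigma> A F"
  unfolding theta_sigma_cofinal_def
proof (intro conjI F allI impI, elim conjE, rule ccontr)
  fix B g
  assume B: "B \<subseteq> A" "|B| <o \<theta>" and g: "g \<in> prod_ord B"
  assume no: "\<nexists>F0 z. F0 \<subseteq> F \<and> |F0| <o \<sigma> \<and> z \<in> sup_ord A \<and> (\<forall>b\<in>B - {..<z}. \<exists>f\<in>F0. g b < f b)"
  \<comment> \<open>The part of \<open>X \<inter> B\<close> where \<open>F0\<close> fails to exceed
    \<open>g\<close>.\<close>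
  define N where "N X F0 = {b \<in> X \<inter> B. \<forall>f\<in>F0. \<not> g b < f b}" for X F0
  define J where "J = {X. X \<subseteq> A \<and> (\<exists>F0. F0 \<subseteq> F \<and> |F0| <o \<sigma> \<and> N X F0 \<in> J_bd A)}"
  have JI: "X \<in> J" if "X \<subseteq> A" "F0 \<subseteq> F" "finite F0" "N X F0 \<in> J_bd A" for X F0
    using that finite_ordLess_regular[OF that(3) \<sigma>] unfolding J_def by blast
  have comp: "complete_ideal \<sigma> J"
    unfolding complete_ideal_def
  proof (intro allI impI, elim conjE)
    fix S assume S: "S \<subseteq> J" "|S| <o \<sigma>"
    then have "\<forall>X\<in>S. \<exists>F0. F0 \<subseteq> F \<and> |F0| <o \<sigma> \<and> N X F0 \<in> J_bd A" unfolding J_def by blast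
    then obtain E where E: "\<And>X. X \<in> S \<Longrightarrow> E X \<subseteq> F" "\<And>X. X \<in> S \<Longrightarrow> |E X| <o \<sigma>"
      "\<And>X. X \<in> S \<Longrightarrow> N X (E X) \<in> J_bd A"
      by metis
    have "|\<Union>X\<in>S. E X| <o \<sigma>"
      using \<sigma> S(2) E(2) card_of_UNION_ordLess_infinite_Field_regularCard
      unfolding regular_cardinal_def by blast
    moreover have "(\<Union>X\<in>S. N X (E X)) \<in> J_bd A" by (rule complete_idealD[OF bd S(2) E(3)])
    then have "N (\<Union>S) (\<Union>X\<in>S. E X) \<in> J_bd A" by (rule J_bd_subset) (auto simp: N_def)
    moreover have "(\<Union>X\<in>S. E X) \<subseteq> F" using E(1) by blast
    moreover have "\<Union>S \<subseteq> A" using S(1) unfolding J_def by blast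
    ultimately show "\<Union>S \<in> J" unfolding J_def by blast
  qed
  have "{} \<in> J_bd A" using J_bd_subset[OF tail] by blast
  have bdJ: "J_bd A \<subseteq> J"
  proof
    fix X assume X: "X \<in> J_bd A"
    then have "N X {} \<in> J_bd A" by (rule J_bd_subset) (auto simp: N_def)
    then show "X \<in> J" using X by (intro JI[of X "{}"]) (auto simp: J_bd_def)
  qed
  \<comment> \<open>Properness is exactly the failure of the covering for \<open>g\<close>.\<close>
  have notA: "A \<notin> J"
  proof
    assume "A \<in> J"
    then obtain F0 where F0: "F0 \<subseteq> F" "|F0| <o \<sigma>" "N A F0 \<in> J_bd A" unfolding J_def by blast
    then obtain z where "z \<in> sup_ord A" "N A F0 \<subseteq> {..<z}" unfolding J_bd_def by blast
    moreover from this have "\<forall>b\<in>B - {..<z}. \<exists>f\<in>F0. g b < f b" using B(1) unfolding N_def by blast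
    ultimately show False using no F0(1,2) by blast
  qed
  have idJ: "ideal_on A J"
  proof (rule complete_ideal_onI[OF \<sigma> comp _ notA])
    show "J \<subseteq> Pow A" unfolding J_def by blast
    fix X Y assume X: "X \<in> J" and Y: "Y \<subseteq> X"
    then obtain F0 where F0: "X \<subseteq> A" "F0 \<subseteq> F" "|F0| <o \<sigma>" "N X F0 \<in> J_bd A"
      unfolding J_def by blast
    have "N Y F0 \<in> J_bd A" using F0(4) by (rule J_bd_subset) (use Y in \<open>auto simp: N_def\<close>)
    then show "Y \<in> J" using F0(1-3) Y unfolding J_def by blast
  qed
  have AB: "A - B \<in> J"
    using \<open>{} \<in> J_bd A\<close> by (intro JI[of "A - B" "{}"]) (auto simp: N_def)
  have "admissible J" using idJ tail bdJ unfolding admissible_def by blast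
  from tcf_extension[OF \<sigma> this comp] obtain J' and \<kappa> :: "('a \<Rightarrow> 'a) rel"
    where J': "J \<subseteq> J'" "ideal_on A J'" "complete_ideal \<sigma> J'" and tcf: "has_tcf A J' \<kappa>"
    by blast
  have adm: "admissible J'" using J' tail bdJ unfolding admissible_def by blast
  have "J_bd A \<subseteq> J'" "A - B \<in> J'" using J'(1) bdJ AB by auto
  then have pcf: "\<kappa> \<in> pcf_Gamma \<theta> \<sigma> A"
    using J' B tcf unfolding pcf_Gamma_def by blast
  obtain g0 where g0: "g0 \<in> prod_ord A" using prod_ord_nonempty by blast
  \<comment> \<open>The values outside \<open>B\<close> are arbitrary, since \<open>A - B\<close> is
    null.\<close>
  define h where "h = (\<lambda>a\<in>A. if a \<in> B then g a else g0 a)"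
  have h: "h \<in> prod_ord A"
    using g0 g by (auto simp: h_def prod_ord_def PiE_iff)
  have "le_mod A J' f h" if f: "f \<in> F" for f
  proof -
    \<comment> \<open>The single function \<open>f\<close> covers \<open>g\<close> on this
      set.\<close>
    have "{a\<in>B. g a < f a} \<in> J"
    proof (rule JI[of _ "{f}"])
      have "N {a\<in>B. g a < f a} {f} = {}" by (auto simp: N_def)
      then show "N {a\<in>B. g a < f a} {f} \<in> J_bd A" using \<open>{} \<in> J_bd A\<close> by simp
    qed (use B(1) f in auto)
    then have "{a\<in>A. \<not> f a \<le> h a} \<in> J"
      by (rule ideal_on_subset_Un[OF idJ AB]) (auto simp: h_def)
    then show ?thesis using J'(1) unfolding le_mod_def by blast
  qed
  then have "bounded_mod A J' F" by (rule bounded_modI_le[OF adm h])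
  then show False using unb[OF adm pcf tcf] by simp
qed

end

theorem theorem3p6:
  fixes \<sigma> :: "'s rel" and \<theta> :: "'t rel" and A :: "'a::wellorder set"
  assumes "regular_cardinal \<sigma>" and "regular_cardinal \<theta>" and "\<sigma> <o \<theta>"
    and "regular_cardinals A" and "progressive A"
    and "pcf_Gamma \<theta> \<sigma> A \<noteq> {}"
  shows "card_Sup (pcf_Gamma \<theta> \<sigma> A) =o cf_bd \<theta> \<sigma> A"
proof -
  let ?P = "pcf_Gamma \<theta> \<sigma> A"
  define S where "S = card_Sup ?P"
  define F where "F = (SOME F. is_min_cofinal \<theta> \<sigma> A F)"
  have cf: "cf_bd \<theta> \<sigma> A = |F|" unfolding cf_bd_def F_def ..
  have reg: "regular_cardinal \<kappa>" if "\<kappa> \<in> ?P" for \<kappa>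
    using that unfolding pcf_Gamma_def has_tcf_def by blast
  then have "is_card_Sup ?P S"
    unfolding S_def by (intro is_card_Sup_card_Sup) (simp add: regular_cardinal_Card_order)
  then have S: "Card_order S" "\<And>\<kappa>. \<kappa> \<in> ?P \<Longrightarrow> \<kappa> \<le>o S"
    "\<And>t :: ('a \<Rightarrow> 'a) rel. Card_order t \<Longrightarrow> \<forall>\<kappa>\<in>?P. \<kappa> \<le>o t \<Longrightarrow> S \<le>o t"
    unfolding is_card_Sup_def by auto
  have "A \<noteq> {}" using assms(5) unfolding progressive_def by simp
  then have "is_min_cofinal \<theta> \<sigma> A F"
    unfolding F_def by (rule someI_ex[OF is_min_cofinal_exists[OF assms(1,4)]])
  then have F: "theta_sigma_cofinal \<theta> \<sigma> A F"
    "\<And>F'. theta_sigma_cofinal \<theta> \<sigma> A F' \<Longrightarrow> |F| \<le>o |F'|"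
    unfolding is_min_cofinal_def by auto
  have "S \<le>o |F|"
    using tcf_ordLeq_cofinal_family[OF _ F(1)] by (intro S(3) card_of_Card_order) auto
  moreover have "|F| \<le>o S"
  proof -
    obtain \<kappa> where \<kappa>: "\<kappa> \<in> ?P" using assms(6) by blast
    obtain J where J: "ideal_on A J" "complete_ideal \<sigma> J" "J_bd A \<subseteq> J"
      using \<kappa> unfolding pcf_Gamma_def by blast
    \<comment> \<open>Some \<kappa> in the pcf set is infinite and lies below \<open>S\<close>; the
      union of universal families needs \<open>S\<close> infinite.\<close>
    have "cinfinite S"
      using cinfinite_mono[OF S(2)[OF \<kappa>]] reg[OF \<kappa>] unfolding regular_cardinal_def by simp
    then have "Cinfinite S" using S(1) by simp
    obtain T v where tail: "progressive_tail A T v" "A - T \<in> J_bd A"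
      using progressive_tail_exists[OF assms(4,5)] by blast
    interpret progressive_tail A T v by (rule tail(1))
    obtain U where U: "U \<subseteq> prod_ord A" "|U| \<le>o S"
      "\<forall>J (\<kappa> :: ('a \<Rightarrow> 'a) rel). admissible J \<and> has_tcf A J \<kappa> \<and> \<kappa> \<le>o S \<longrightarrow> \<not> bounded_mod A J U"
      using universal_family_upto[OF \<open>Cinfinite S\<close>] by (elim exE conjE)
    have "theta_sigma_cofinal \<theta> \<sigma> A U"
      by (rule universal_family_cofinal[OF assms(1) tail(2) J_bd_complete[OF assms(4,5) J] U(1)])
        (use U(3) S(2) in blast)
    then show ?thesis using ordLeq_transitive[OF F(2) U(2)] by simp
  qed
  ultimately show ?thesis
    unfolding cf S_def[symmetric] by (simp add: ordIso_iff_ordLeq)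
qed

end
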